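(* One has $$\lim_{\lambda\to-\infty}Gr(\gamma_\lambda(T))=\Lambda_D\quad\text{in }\mathrm{Lag}(\mathcal V,\Omega).$$ Furthermore, let $\lambda(s)=\tan s$, and set $Gr(\gamma_{\lambda(-\pi/2)}(T)):=\Lambda_D$, so that $s\mapsto Gr(\gamma_{\lambda(s)}(T))$ is a continuous path on $[-\pi/2,-\pi/2+\epsilon]$. Then for all sufficiently small $\epsilon>0$, $$\mu(\Lambda_D,Gr(\gamma_{\lambda(s)}(T)),s\in[-\pi/2,-\pi/2+\epsilon])=2n.$$
   Context: Setting. Let $n\ge1$, $T>0$, $P,Q\in H^1([0,T],L(n))$, $R\in C([0,T],L(n))$, where $L(n)$ is the set of real $n\times n$ matrices; $P(t),R(t)$ are symmetric and $P(t)$ is positive definite for all $t\in[0,T]$. Let $J_m=\begin{bmatrix}0&-I_m\\ I_m&0\end{bmatrix}$. For real $\lambda$ let $$\mathcal B_\lambda=\begin{bmatrix}P^{-1}&-P^{-1}Q\\ -Q^TP^{-1}&Q^TP^{-1}Q-R+\lambda I_n\end{bmatrix},$$ and let $\gamma_\lambda$ be the fundamental solution: $\dot\gamma_\lambda(t)=J_n\mathcal B_\lambda(t)\gamma_\lambda(t)$, $\gamma_\lambda(0)=I_{2n}$. (This is the first-order form, with $z=(y,x)$, $y=P\dot x+Qx$, of $-\frac{d}{dt}(P\dot x+Qx)+Q^T\dot x+Rx=\lambda x$.) Then $\gamma_\lambda(T)$ is a real symplectic matrix and $Gr(\gamma_\lambda(T))=\{(u,\gamma_\lambda(T)u):u\in\mathbf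 C^{2n}\}$. Let $\omega_m(u,v)=\langle J_mu,v\rangle$ on $\mathbf C^{2m}$ (standard Hermitian product), and $(\mathcal V,\Omega)=(\mathbf C^{2n}\oplus\mathbf C^{2n},-\omega_n\oplus\omega_n)$. $\mathrm{Lag}(\mathcal V,\Omega)$ is the set of complex subspaces $\Lambda\subset\mathcal V$ with $\Omega|_\Lambda=0$ and $\dim_{\mathbf C}\Lambda=2n$; it contains $Gr(\gamma_\lambda(T))$. Vectors of $\mathcal V$ are written $(z(0),z(T))$ with $z(0)=(y(0),x(0))$, $z(T)=(y(T),x(T))$; $\Lambda_D=\{x(0)=x(T)=0\}$. Topology and Maslov index. In the coordinates $(-y(0),y(T),x(0),x(T))$ the form $\Omega$ becomes $\omega_{2n}$. If in these coordinates $\Lambda$ is the column space of $\begin{bmatrix}X\\ Y\end{bmatrix}$ ($X,Y$ complex $2n\times2n$, rank $2n$, $X^*Y=Y^*X$), put $\mathcal U(\Lambda)=(X+iY)(X-iY)^{-1}\in\mathbf U(2n)$; this is independent of the choice of frame, and $\mathrm{Lag}(\mathcal V,\Omega)$ carries the metric $\|\mathcal U(\Lambda_1)-\mathcal U(\Lambda_2)\|$. For a continuous path $\Lambda(t)$, $t\in[a,b]$, and a Lagrangian $\Lambda'$, choose continuous $\theta_1,\dots,\theta_{2n}:[a,b]\to\mathbf R$ such that $e^{i\theta_j(t)}$ are the eigenvalues of $\mathcal U(\Lambda')^{-1}\mathcal U(\Lambda(t))$ with multiplicity; the Maslov index is $\mu(\Lambda',\Lambda(t),t\in[a,b])=\sum_{j=1}^{2n}\left(\left\lceil\frac{\theta_j(b)}{2\pi}\right\rceil-\left\lceil\frac{\theta_j(a)}{2\pi}\right\rceil\right)$.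 *)

theory Defs
  imports "HOL-Analysis.Analysis"
begin

section \<open>The Sturm--Liouville system\<close>

text \<open>The Sobolev space \<open>H\<^sup>1([0,T])\<close>; its elements are represented by their continuous
  representatives, that is, by the primitives of square integrable functions.\<close>

definition H1_on :: "real \<Rightarrow> (real \<Rightarrow> 'a::{banach,second_countable_topology}) \<Rightarrow> bool" where
  "H1_on T f \<longleftrightarrow>
     (\<exists>g. set_borel_measurable lebesgue {0..T} g \<and>
          set_integrable lebesgue {0..T} (\<lambda>t. (norm (g t))\<^sup>2) \<and>
          (\<forall>t\<in>{0..T}. f t = f 0 + (LINT s:{0..t}|lebesgue. g s)))"

definition symmetric_mat :: "real^'n^'n \<Rightarrow> bool" where
  "symmetric_mat A \<longleftrightarrow> transpose A = A"

definition positive_definite :: "real^'n^'n \<Rightarrow> bool" where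
  "positive_definite A \<longleftrightarrow> (\<forall>x. x \<noteq> 0 \<longrightarrow> x \<bullet> (A *v x) > 0)"

text \<open>The dimension \<open>2m\<close> is the index type \<^typ>\<open>'m + 'm\<close>: \<^const>\<open>Inl\<close> indexes the first
  \<open>m\<close> coordinates, \<^const>\<open>Inr\<close> the last \<open>m\<close>. A matrix is the vector of its rows, so
  \<open>vjoin\<close> also stacks two matrices on top of each other.\<close>

definition vjoin :: "'a^'m \<Rightarrow> 'a^'k \<Rightarrow> 'a^('m::finite + 'k::finite)" where
  "vjoin u v = (\<chi> i. case i of Inl j \<Rightarrow> u $ j | Inr j \<Rightarrow> v $ j)"

definition vfst :: "'a^('m::finite + 'k::finite) \<Rightarrow> 'a^'m" where
  "vfst v = (\<chi> i. v $ Inl i)"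

definition vsnd :: "'a^('m::finite + 'k::finite) \<Rightarrow> 'a^'k" where
  "vsnd v = (\<chi> i. v $ Inr i)"

definition block_mat ::
    "'a^'m^'m \<Rightarrow> 'a^'m^'m \<Rightarrow> 'a^'m^'m \<Rightarrow> 'a^'m^'m \<Rightarrow> 'a^('m::finite + 'm)^('m + 'm)" where
  "block_mat A B C D = vjoin (\<chi> i. vjoin (A $ i) (B $ i)) (\<chi> i. vjoin (C $ i) (D $ i))"

definition J_mat :: "'a::comm_ring_1^('m::finite + 'm)^('m + 'm)" where
  "J_mat = block_mat 0 (- mat 1) (mat 1) 0"

definition B_mat ::
    "(real \<Rightarrow> real^'n^'n) \<Rightarrow> (real \<Rightarrow> real^'n^'n) \<Rightarrow> (real \<Rightarrow> real^'n^'n) \<Rightarrow> real \<Rightarrow> real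
      \<Rightarrow> real^('n::finite + 'n)^('n + 'n)" where
  "B_mat P Q R l t =
     block_mat (matrix_inv (P t)) (- (matrix_inv (P t) ** Q t))
       (- (transpose (Q t) ** matrix_inv (P t)))
       (transpose (Q t) ** matrix_inv (P t) ** Q t - R t + l *\<^sub>R mat 1)"

definition fundamental_solution ::
    "real \<Rightarrow> (real \<Rightarrow> real^'m^'m) \<Rightarrow> (real \<Rightarrow> real^'m^'m) \<Rightarrow> bool" where
  "fundamental_solution T A Y \<longleftrightarrow>
     Y 0 = mat 1 \<and>
     (\<forall>t\<in>{0..T}. (Y has_vector_derivative (A t ** Y t)) (at t within {0..T}))"

section \<open>The Lagrangian Grassmannian\<close>

definition herm_inner :: "complex^'m \<Rightarrow> complex^'m \<Rightarrow> complex" where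
  "herm_inner u v = (\<Sum>i\<in>UNIV. u $ i * cnj (v $ i))"

definition omega :: "complex^('m::finite + 'm) \<Rightarrow> complex^('m + 'm) \<Rightarrow> complex" where
  "omega u v = herm_inner (J_mat *v u) v"

text \<open>The space \<open>\<V> = \<complex>\<^sup>2\<^sup>n \<oplus> \<complex>\<^sup>2\<^sup>n\<close> of boundary values \<open>(z(0), z(T))\<close>, with
  \<open>z = (y, x)\<close>: the components of \<open>y(0)\<close>, \<open>x(0)\<close>, \<open>y(T)\<close>, \<open>x(T)\<close> have the indices
  \<open>Inl (Inl k)\<close>, \<open>Inl (Inr k)\<close>, \<open>Inr (Inl k)\<close>, \<open>Inr (Inr k)\<close> respectively.\<close>

type_synonym 'n bdry = "complex^(('n + 'n) + ('n + 'n))"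

definition Omega :: "'n::finite bdry \<Rightarrow> 'n bdry \<Rightarrow> complex" where
  "Omega u v = - omega (vfst u) (vfst v) + omega (vsnd u) (vsnd v)"

definition Lag :: "'n::finite bdry set set" where
  "Lag = {L. vec.subspace L \<and> vec.dim L = 2 * CARD('n) \<and> (\<forall>u\<in>L. \<forall>v\<in>L. Omega u v = 0)}"

definition Gr :: "real^('n + 'n)^('n + 'n) \<Rightarrow> 'n::finite bdry set" where
  "Gr M = {vjoin u (map_matrix complex_of_real M *v u) | u. True}"

definition Lambda_D :: "'n::finite bdry set" where
  "Lambda_D = {v. vsnd (vfst v) = 0 \<and> vsnd (vsnd v) = 0}"

text \<open>The coordinates \<open>(-y(0), y(T), x(0), x(T))\<close>.\<close>

definition canon :: "'n::finite bdry \<Rightarrow> 'n bdry" where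
  "canon v = vjoin (vjoin (- vfst (vfst v)) (vfst (vsnd v)))
                   (vjoin (vsnd (vfst v)) (vsnd (vsnd v)))"

definition conj_transpose :: "complex^'m^'k \<Rightarrow> complex^'k^'m" where
  "conj_transpose A = (\<chi> i j. cnj (A $ j $ i))"

definition lag_frame ::
    "complex^('n + 'n)^('n + 'n) \<Rightarrow> complex^('n + 'n)^('n + 'n) \<Rightarrow> 'n::finite bdry set \<Rightarrow> bool" where
  "lag_frame X Y L \<longleftrightarrow>
     canon ` L = vec.span (columns (vjoin X Y)) \<and> rank (vjoin X Y) = 2 * CARD('n) \<and>
     conj_transpose X ** Y = conj_transpose Y ** X"

definition lag_U :: "'n::finite bdry set \<Rightarrow> complex^('n + 'n)^('n + 'n)" where
  "lag_U L = (THE U. \<exists>X Y. lag_frame X Y L \<and>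
                U = (X + mat \<i> ** Y) ** matrix_inv (X - mat \<i> ** Y))"

text \<open>The library norm on matrices is the Frobenius norm; all norms give the same topology.\<close>

definition lag_dist :: "'n::finite bdry set \<Rightarrow> 'n bdry set \<Rightarrow> real" where
  "lag_dist L1 L2 = norm (lag_U L1 - lag_U L2)"

definition lag_topology :: "'n::finite bdry set topology" where
  "lag_topology = Metric_space.mtopology Lag lag_dist"

section \<open>The Maslov index\<close>

text \<open>The eigenvalues of \<open>M\<close>, with multiplicity, are \<open>z\<^sub>j\<close>, \<open>j\<close> ranging over the index type.\<close>

definition eigenvalues_are :: "complex^'m^'m \<Rightarrow> ('m::finite \<Rightarrow> complex) \<Rightarrow> bool" where
  "eigenvalues_are M z \<longleftrightarrow> (\<forall>x. det (mat x - M) = (\<Prod>j\<in>UNIV. (x - z j)))"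

definition eigen_angles ::
    "'n::finite bdry set \<Rightarrow> (real \<Rightarrow> 'n bdry set) \<Rightarrow> real \<Rightarrow> real \<Rightarrow> ('n + 'n \<Rightarrow> real \<Rightarrow> real) \<Rightarrow> bool"
  where
  "eigen_angles L' L a b \<theta> \<longleftrightarrow>
     (\<forall>j. continuous_on {a..b} (\<theta> j)) \<and>
     (\<forall>t\<in>{a..b}. eigenvalues_are (matrix_inv (lag_U L') ** lag_U (L t)) (\<lambda>j. cis (\<theta> j t)))"

text \<open>The index does not depend on the choice of the \<open>\<theta>\<^sub>j\<close>: the sum of the
  \<open>\<theta>\<^sub>j(b) - \<theta>\<^sub>j(a)\<close> is the variation of the argument of the determinant, and
  \<open>\<lceil>x\<rceil> - x\<close> has period 1.\<close>

definition maslov :: "'n::finite bdry set \<Rightarrow> (real \<Rightarrow> 'n bdry set) \<Rightarrow> real \<Rightarrow> real \<Rightarrow> int" where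
  "maslov L' L a b =
     (THE k. \<exists>\<theta>. eigen_angles L' L a b \<theta> \<and>
        k = (\<Sum>j\<in>UNIV. (\<lceil>\<theta> j b / (2 * pi)\<rceil> - \<lceil>\<theta> j a / (2 * pi)\<rceil>)))"

text \<open>The path \<open>s \<mapsto> Gr(\<gamma>\<^bsub>tan s\<^esub>(T))\<close>, extended by \<open>\<Lambda>\<^sub>D\<close> at
  \<open>s = -\<pi>/2\<close> (where the library gives \<open>tan\<close> the value 0).\<close>

definition graph_path ::
    "(real \<Rightarrow> real \<Rightarrow> real^('n + 'n)^('n + 'n)) \<Rightarrow> real \<Rightarrow> real \<Rightarrow> 'n::finite bdry set" where
  "graph_path \<gamma> T s = (if s = - pi / 2 then Lambda_D else Gr (\<gamma> (tan s) T))"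

section \<open>Well-definedness\<close>

text \<open>Every Lagrangian subspace has a frame, \<^const>\<open>lag_U\<close> is independent of it
  (\<open>lag_U_eq\<close>), and \<^const>\<open>lag_dist\<close> is a metric on \<^const>\<open>Lag\<close>
  (\<open>Metric_space_Lag\<close>).\<close>

lemma vjoin_simps [simp]: "vjoin u v $ Inl i = u $ i" "vjoin u v $ Inr j = v $ j"
  by (simp_all add: vjoin_def)
lemma vfst_vjoin [simp]: "vfst (vjoin u v) = u" "vsnd (vjoin u v) = v"
  by (simp_all add: vfst_def vsnd_def vec_eq_iff)
lemma vjoin_eta [simp]: "vjoin (vfst v) (vsnd v) = v"
  unfolding vec_eq_iff
proof
  fix i
  show "vjoin (vfst v) (vsnd v) $ i = v $ i"
    by (cases i) (simp_all add: vfst_def vsnd_def)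
qed
lemma vjoin_inj: "vjoin a b = vjoin c d \<longleftrightarrow> a = c \<and> b = d"
  by (metis vfst_vjoin)

lemma sum_UNIV_plus: "sum f (UNIV::('a::finite+'b::finite) set) = (\<Sum>i\<in>UNIV. f (Inl i)) + (\<Sum>i\<in>UNIV. f (Inr i))"
  using sum.Plus[of "UNIV :: 'a set" "UNIV :: 'b set" f] by (simp add: comp_def)

lemma blockmul: "block_mat A B C D *v vjoin u v = vjoin (A *v u + B *v v) (C *v u + D *v (v::'a::comm_ring_1^'m))"
  unfolding vec_eq_iff
proof
  fix i :: "'m + 'm"
  show "(block_mat A B C D *v vjoin u v) $ i = vjoin (A *v u + B *v v) (C *v u + D *v v) $ i"
    by (cases i) (simp_all add: block_mat_def matrix_vector_mult_def sum_UNIV_plus)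
qed

lemma omega_eq: "omega (vjoin a b) (vjoin c d) = herm_inner a d - herm_inner b c"
  unfolding omega_def J_mat_def blockmul
  apply (simp add: herm_inner_def sum_UNIV_plus)
  by (simp add: matrix_vector_mult_def mat_def sum_negf if_distrib if_distribR cong: if_cong)

lemma herm_join: "herm_inner (vjoin a b) (vjoin c d) = herm_inner a c + herm_inner b d"
  by (simp add: herm_inner_def sum_UNIV_plus)
lemma herm_minus [simp]: "herm_inner (-a) b = - herm_inner a b" "herm_inner a (-b) = - herm_inner a b"
  by (simp_all add: herm_inner_def sum_negf)

lemma Omega_canon: "Omega u v = omega (canon u) (canon v)"
proof -
  have "omega (vfst u) (vfst v) = herm_inner (vfst (vfst u)) (vsnd (vfst v)) - herm_inner (vsnd (vfst u)) (vfst (vfst v))"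
    for u v :: "'a bdry"
    using omega_eq[of "vfst (vfst u)" "vsnd (vfst u)" "vfst (vfst v)" "vsnd (vfst v)"] by simp
  moreover have "omega (vsnd u) (vsnd v) = herm_inner (vfst (vsnd u)) (vsnd (vsnd v)) - herm_inner (vsnd (vsnd u)) (vfst (vsnd v))"
    for u v :: "'a bdry"
    using omega_eq[of "vfst (vsnd u)" "vsnd (vsnd u)" "vfst (vsnd v)" "vsnd (vsnd v)"] by simp
  ultimately show ?thesis
    by (simp add: Omega_def canon_def omega_eq herm_join)
qed

lemma canon_add: "canon (u + v) = canon u + canon v"
  by (simp add: canon_def vec_eq_iff vfst_def vsnd_def vjoin_def split: sum.split)
lemma canon_scale: "canon (c *s v) = c *s canon v"
  by (simp add: canon_def vec_eq_iff vfst_def vsnd_def vjoin_def split: sum.split)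
lemma inj_canon: "inj canon"
proof (rule injI)
  fix x y :: "'a bdry" assume a: "canon x = canon y"
  have "vjoin (vjoin (- vfst (vfst x)) (vfst (vsnd x))) (vjoin (vsnd (vfst x)) (vsnd (vsnd x))) =
        vjoin (vjoin (- vfst (vfst y)) (vfst (vsnd y))) (vjoin (vsnd (vfst y)) (vsnd (vsnd y)))"
    using a by (simp add: canon_def)
  then have eq: "vfst (vfst x) = vfst (vfst y)" "vfst (vsnd x) = vfst (vsnd y)"
    "vsnd (vfst x) = vsnd (vfst y)" "vsnd (vsnd x) = vsnd (vsnd y)"
    by (simp_all add: vjoin_inj)
  have "x = vjoin (vjoin (vfst (vfst x)) (vsnd (vfst x))) (vjoin (vfst (vsnd x)) (vsnd (vsnd x)))"
    by simp
  also have "\<dots> = vjoin (vjoin (vfst (vfst y)) (vsnd (vfst y))) (vjoin (vfst (vsnd y)) (vsnd (vsnd y)))"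
    by (simp only: eq)
  finally show "x = y" by simp
qed
lemma canon_lin: "Vector_Spaces.linear (*s) (*s) canon"
  by (unfold_locales) (simp_all add: canon_add canon_scale)

lemma span_columns: "vec.span (columns (A::complex^'m^'k)) = range ((*v) A)"
proof
  show "range ((*v) A) \<subseteq> vec.span (columns A)" by (auto simp: matrix_vector_mult_in_columnspace_gen)
  have "columns A \<subseteq> range ((*v) A)"
  proof
    fix x assume "x \<in> columns A"
    then obtain i where "x = column i A" by (auto simp: columns_def)
    then have "x = A *v axis i 1" by (simp add: vec_eq_iff column_def matrix_vector_mult_def axis_def if_distrib if_distribR cong: if_cong)
    then show "x \<in> range ((*v) A)" by blast
  qed
  then show "vec.span (columns A) \<subseteq> range ((*v) A)"
    by (simp add: vec.span_minimal vec.subspace_image)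
qed

lemma rank_full: "rank (A::complex^'m^'k) = CARD('m) \<longleftrightarrow> inj ((*v) A)"
  unfolding matrix_left_invertible_injective[symmetric] matrix_left_invertible_span_rows_gen row_rank_def_gen
  by (simp add: vec.dim_eq_full[symmetric] card_cart_basis vec.dimension_def)

lemma vjoin_mult: "vjoin X Y *v c = vjoin (X *v c) (Y *v (c::complex^'m))"
  unfolding vec_eq_iff
proof
  fix i
  show "(vjoin X Y *v c) $ i = vjoin (X *v c) (Y *v c) $ i"
    by (cases i) (simp_all add: matrix_vector_mult_def)
qed

lemma card2: "CARD('n::finite + 'n) = 2 * CARD('n)" by (simp)

lemma herm_adj: "herm_inner (A *v u) v = herm_inner u (conj_transpose A *v v)"
proof -
  have "herm_inner (A *v u) v = (\<Sum>i\<in>UNIV. \<Sum>j\<in>UNIV. A $ i $ j * u $ j * cnj (v $ i))"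
    by (simp add: herm_inner_def matrix_vector_mult_def sum_distrib_right)
  also have "\<dots> = (\<Sum>j\<in>UNIV. \<Sum>i\<in>UNIV. A $ i $ j * u $ j * cnj (v $ i))" by (rule sum.swap)
  also have "\<dots> = herm_inner u (conj_transpose A *v v)"
    by (simp add: herm_inner_def matrix_vector_mult_def conj_transpose_def sum_distrib_left mult_ac)
  finally show ?thesis .
qed

lemma herm_diff: "herm_inner a (b - c) = herm_inner a b - herm_inner a c"
  by (simp add: herm_inner_def algebra_simps sum_subtractf)
lemma herm_axis: "herm_inner (axis i 1) v = cnj (v $ i)"
  by (simp add: herm_inner_def axis_def if_distrib if_distribR cong: if_cong)

lemma frame_exists:
  assumes "L \<in> Lag" shows "\<exists>X Y. lag_frame X Y (L :: 'n::finite bdry set)"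
proof -
  have L: "vec.subspace L" "vec.dim L = 2 * CARD('n)" "\<And>u v. u \<in> L \<Longrightarrow> v \<in> L \<Longrightarrow> Omega u v = 0"
    using assms by (auto simp: Lag_def)
  interpret c: Vector_Spaces.linear "(*s)" "(*s)" "canon :: 'n bdry \<Rightarrow> _" by (rule canon_lin)
  have sub: "vec.subspace (canon ` L)" using L(1) c.subspace_image by blast
  have dim: "vec.dim (canon ` L) = CARD('n + 'n)"
    using vec.dim_image_eq[OF canon_lin, of L] inj_canon L(2) by (metis card2 inj_on_subset subset_UNIV)
  obtain B where B: "B \<subseteq> canon ` L" "vec.independent B" "canon ` L \<subseteq> vec.span B" "card B = CARD('n+'n)"
    using vec.basis_exists[of "canon ` L"] dim by metis
  have sp: "vec.span B = canon ` L" using B sub by (meson subset_antisym vec.span_minimal)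
  obtain f where f: "bij_betw f (UNIV::('n+'n) set) B"
    using B(4) by (metis card_eq_0_iff finite_same_card_bij finite_UNIV zero_less_card_finite less_irrefl)
  define M :: "complex^('n + 'n)^(('n + 'n) + ('n+'n))" where "M = (\<chi> i j. f j $ i)"
  have col: "column i M = f i" for i by (simp add: column_def M_def)
  have cols: "columns M = B" using f by (auto simp: columns_def col bij_betw_def)
  have inj: "inj ((*v) M)"
  proof -
    have "c i = 0" if "sum (\<lambda>i. c i *s column i M) UNIV = 0" for c i
    proof -
      have "sum (\<lambda>b. c (inv f b) *s b) B = sum (\<lambda>i. c i *s f i) UNIV"
        using f by (intro sum.reindex_bij_witness[of _ f "inv f"]) (auto simp: bij_betw_def inv_f_f f_inv_into_f)
      then have "sum (\<lambda>b. c (inv f b) *s b) B = 0" using that by (simp add: col)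
      moreover have "finite B" "f i \<in> B" using f by (auto simp: bij_betw_def)
      ultimately have "c (inv f (f i)) = 0"
        by (intro vec.independentD[OF B(2) _ subset_refl, where u = "\<lambda>b. c (inv f b)"])
      then show "c i = 0" using f by (simp add: bij_betw_def inv_f_f)
    qed
    then show ?thesis
      unfolding matrix_left_invertible_injective[symmetric] matrix_left_invertible_independent_columns by blast
  qed
  have iso: "omega (M *v a) (M *v b) = 0" for a b
  proof -
    have "M *v a \<in> canon ` L" "M *v b \<in> canon ` L"
      using span_columns[of M] cols sp by auto
    then show ?thesis using L(3) by (auto simp: Omega_canon)
  qed
  have "conj_transpose (vfst M) ** vsnd M = conj_transpose (vsnd M) ** vfst M"
  proof -
    have "(conj_transpose (vfst M) ** vsnd M) *v b = (conj_transpose (vsnd M) ** vfst M) *v b" for b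
    proof -
      have "herm_inner a ((conj_transpose (vfst M) ** vsnd M) *v b - (conj_transpose (vsnd M) ** vfst M) *v b) = 0" for a
      proof -
        have "omega (vjoin (vfst M) (vsnd M) *v a) (vjoin (vfst M) (vsnd M) *v b) = 0"
          using iso[of a b] by simp
        then show ?thesis
          unfolding vjoin_mult omega_eq herm_diff herm_adj by (simp add: matrix_vector_mul_assoc)
      qed
      from this[of "axis _ 1"] show ?thesis by (simp add: herm_axis vec_eq_iff)
    qed
    then show ?thesis by (simp add: matrix_eq)
  qed
  then have "lag_frame (vfst M) (vsnd M) L"
    using inj cols sp rank_full[of M] by (simp add: lag_frame_def)
  then show ?thesis by blast
qed

lemma mat_mult_vec: "mat c *v (v::complex^'m) = c *s v"
  by (simp add: vec_eq_iff matrix_vector_mult_def mat_def if_distrib if_distribR cong: if_cong)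

lemma herm_self: "herm_inner v v = of_real (norm v ^ 2)"
  unfolding herm_inner_def norm_vec_def L2_set_def
  by (simp add: sum_nonneg complex_norm_square[symmetric])

lemma herm_add: "herm_inner (a + b) c = herm_inner a c + herm_inner b c"
  "herm_inner a (b + c) = herm_inner a b + herm_inner a c"
  "herm_inner (a - b) c = herm_inner a c - herm_inner b c"
  "herm_inner (z *s a) c = z * herm_inner a c" "herm_inner a (z *s c) = cnj z * herm_inner a c"
  by (simp_all add: herm_inner_def algebra_simps sum.distrib sum_subtractf sum_distrib_left)

lemma mat_mult_add: "(A + B) *v (v::complex^'m) = A *v v + B *v v" "(A - B) *v v = A *v v - B *v v"
  by (simp_all add: matrix_vector_mult_add_rdistrib matrix_vector_mult_diff_rdistrib)

lemma frame_inv: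
  assumes "lag_frame X Y (L :: 'n::finite bdry set)"
  shows "invertible (X - mat \<i> ** Y)" "invertible (X + mat \<i> ** Y)"
proof -
  have inj: "inj ((*v) (vjoin X Y))" using assms rank_full[of "vjoin X Y"] by (simp add: lag_frame_def)
  have sym: "herm_inner (X *v c) (Y *v c) = herm_inner (Y *v c) (X *v c)" for c
    using assms by (simp add: lag_frame_def herm_adj matrix_vector_mul_assoc)
  have 1: "c = 0" if "X *v c = 0" "Y *v c = 0" for c
  proof -
    have "vjoin X Y *v c = 0" using that unfolding vjoin_mult by (simp add: vec_eq_iff vjoin_def split: sum.split)
    then show ?thesis using inj by (metis injD matrix_vector_mult_0_right)
  qed
  have 2: "herm_inner (X *v c - z *s (Y *v c)) (X *v c - z *s (Y *v c)) = of_real (norm (X *v c)^2 + norm (Y *v c) ^2)"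
    if "z = \<i> \<or> z = -\<i>" for z c
    proof -
    have e: "herm_inner (x - z *s y) (x - z *s y) = herm_inner x x + herm_inner y y"
      if "herm_inner x y = herm_inner y x" for x y :: "complex^('n+'n)"
      using that \<open>z = \<i> \<or> z = -\<i>\<close> unfolding herm_add herm_diff by (auto simp: algebra_simps)
    show ?thesis unfolding e[OF sym] by (simp add: herm_self)
  qed
  have 3: "c = 0" if "z = \<i> \<or> z = -\<i>" "X *v c - z *s (Y *v c) = 0" for z c
  proof -
    have "norm (X *v c)^2 + norm (Y *v c) ^2 = 0"
      using 2[OF that(1), of c] that(2) by (metis herm_self norm_zero of_real_eq_0_iff power_zero_numeral)
    then show ?thesis using 1 by (simp add: sum_power2_eq_zero_iff)
  qed
  show "invertible (X - mat \<i> ** Y)"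
    unfolding invertible_left_inverse matrix_left_invertible_ker
  proof (intro allI impI)
    fix c assume "(X - mat \<i> ** Y) *v c = 0"
    then have "X *v c - \<i> *s (Y *v c) = 0"
      by (simp only: mat_mult_add mat_mult_vec flip: matrix_vector_mul_assoc)
    then show "c = 0" using 3[of "\<i>" c] by simp
  qed
  show "invertible (X + mat \<i> ** Y)"
    unfolding invertible_left_inverse matrix_left_invertible_ker
  proof (intro allI impI)
    fix c assume "(X + mat \<i> ** Y) *v c = 0"
    then have "X *v c + \<i> *s (Y *v c) = 0"
      by (simp only: mat_mult_add mat_mult_vec flip: matrix_vector_mul_assoc)
    then show "c = 0" using 3[of "-\<i>" c] by simp
  qed
qed

lemma frame_char:
  assumes "lag_frame X Y (L :: 'n::finite bdry set)" and U: "U = (X + mat \<i> ** Y) ** matrix_inv (X - mat \<i> ** Y)"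
  shows "canon ` L = {vjoin a b | a b. a + \<i> *s b = U *v (a - \<i> *s b)}"
proof -
  let ?p = "X + mat \<i> ** Y" and ?m = "X - mat \<i> ** Y"
  note inv = frame_inv[OF assms(1)]
  have mi: "matrix_inv ?m ** ?m = mat 1" "?m ** matrix_inv ?m = mat 1"
    using inv(1) unfolding invertible_def matrix_inv_def using someI_ex[of "\<lambda>A'. ?m ** A' = mat 1 \<and> A' ** ?m = mat 1"] by blast+
  have Um: "U ** ?m = ?p" by (simp add: U matrix_mul_assoc[symmetric] mi)
  have pc: "?p *v c = X *v c + \<i> *s (Y *v c)" "?m *v c = X *v c - \<i> *s (Y *v c)" for c
    by (simp_all only: mat_mult_add mat_mult_vec flip: matrix_vector_mul_assoc)
  have L: "canon ` L = range (\<lambda>c. vjoin (X *v c) (Y *v c))"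
    using assms(1) by (simp add: lag_frame_def span_columns vjoin_mult)
  show ?thesis
  proof
    show "canon ` L \<subseteq> {vjoin a b | a b. a + \<i> *s b = U *v (a - \<i> *s b)}"
    proof -
      have "X *v c + \<i> *s (Y *v c) = U *v (X *v c - \<i> *s (Y *v c))" for c
        by (metis Um pc matrix_vector_mul_assoc)
      then show ?thesis unfolding L by blast
    qed
    show "{vjoin a b | a b. a + \<i> *s b = U *v (a - \<i> *s b)} \<subseteq> canon ` L"
    proof safe
      fix a b :: "complex^('n+'n)" assume ab: "a + \<i> *s b = U *v (a - \<i> *s b)"
      define c where "c = matrix_inv ?m *v (a - \<i> *s b)"
      have m: "?m *v c = a - \<i> *s b" unfolding c_def by (simp add: matrix_vector_mul_assoc mi)
      have p: "?p *v c = a + \<i> *s b" using ab m Um by (metis matrix_vector_mul_assoc)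
      have "X *v c = (1/2) *s (?m *v c + ?p *v c)" by (simp add: pc vec_eq_iff)
      also have "\<dots> = a" unfolding m p by (simp add: vec_eq_iff)
      finally have a: "X *v c = a" .
      then have "Y *v c = b" using m pc[of c] by simp
      with a show "vjoin a b \<in> canon ` L" unfolding L by blast
    qed
  qed
qed

lemma vjoin_mem: "vjoin a b \<in> {vjoin a b | a b. K a b} \<longleftrightarrow> K a b"
  by (simp add: vjoin_inj)

lemma char_inj:
  assumes "{vjoin a b | a b. a + \<i> *s b = U *v (a - \<i> *s b)} = {vjoin a b | a b. a + \<i> *s b = V *v (a - \<i> *s b)}"
  shows "U = (V :: complex^'m^'m)"
proof -
  have eq: "a + \<i> *s b = U *v (a - \<i> *s b) \<longleftrightarrow> a + \<i> *s b = V *v (a - \<i> *s b)" for a b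
    using arg_cong[OF assms, of "\<lambda>S. vjoin a b \<in> S"] unfolding vjoin_mem .
  have "U *v w = V *v w" for w
  proof -
    define a b where "a = (1/2) *s (w + U *v w)" and "b = (\<i>/2) *s (w - U *v w)"
    have "\<i> * (\<i> * z) = - z" for z
      by (simp flip: mult.assoc)
    then have "\<i> *s b = (-1/2) *s (w - U *v w)"
      by (simp add: b_def vec_eq_iff)
    then have ib: "\<i> *s b = (1/2) *s (U *v w) - (1/2) *s w"
      by (simp add: vector_ssub_ldistrib)
    have half: "(1/2) *s v + (1/2) *s v = v" for v :: "complex^'m"
      by (simp flip: vector_sadd_rdistrib)
    have 1: "a - \<i> *s b = w" "a + \<i> *s b = U *v w"
      unfolding ib a_def vector_add_ldistrib
      using half[of w] half[of "U *v w"] by (simp_all add: algebra_simps)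
    show ?thesis using eq[of a b] unfolding 1 by simp
  qed
  then show ?thesis by (simp add: matrix_eq)
qed

lemma lag_U_eq:
  assumes "lag_frame X Y (L :: 'n::finite bdry set)"
  shows "lag_U L = (X + mat \<i> ** Y) ** matrix_inv (X - mat \<i> ** Y)"
  unfolding lag_U_def
proof (rule the_equality)
  show "\<exists>X' Y'. lag_frame X' Y' L \<and> (X + mat \<i> ** Y) ** matrix_inv (X - mat \<i> ** Y) = (X' + mat \<i> ** Y') ** matrix_inv (X' - mat \<i> ** Y')"
    using assms by blast
  fix U assume "\<exists>X Y. lag_frame X Y L \<and> U = (X + mat \<i> ** Y) ** matrix_inv (X - mat \<i> ** Y)"
  then obtain X' Y' where "lag_frame X' Y' L" "U = (X' + mat \<i> ** Y') ** matrix_inv (X' - mat \<i> ** Y')" by blast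
  then show "U = (X + mat \<i> ** Y) ** matrix_inv (X - mat \<i> ** Y)"
    using frame_char[OF \<open>lag_frame X' Y' L\<close>, of U] frame_char[OF assms refl]
    by (intro char_inj) simp
qed

lemma lag_U_char:
  assumes "L \<in> Lag"
  shows "canon ` L = {vjoin a b | a b. a + \<i> *s b = lag_U L *v (a - \<i> *s b)}"
proof -
  obtain X Y where "lag_frame X Y L" using frame_exists[OF assms] by blast
  then show ?thesis using frame_char lag_U_eq by blast
qed

lemma Metric_space_Lag: "Metric_space Lag (lag_dist :: 'n::finite bdry set \<Rightarrow> _)"
proof
  fix x y z :: "'n bdry set"
  show "0 \<le> lag_dist x y" by (simp add: lag_dist_def)
  show "lag_dist x y = lag_dist y x" by (simp add: lag_dist_def norm_minus_commute)
  show "lag_dist x z \<le> lag_dist x y + lag_dist y z"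
    using norm_triangle_ineq[of "lag_U x - lag_U y" "lag_U y - lag_U z"] by (simp add: lag_dist_def)
  assume xy: "x \<in> Lag" "y \<in> Lag"
  show "lag_dist x y = 0 \<longleftrightarrow> x = y"
  proof
    assume "lag_dist x y = 0"
    then have "canon ` x = canon ` y"
      unfolding lag_U_char[OF xy(1)] lag_U_char[OF xy(2)] by (simp add: lag_dist_def)
    then show "x = y" by (simp add: inj_image_eq_iff[OF inj_canon])
  qed (simp add: lag_dist_def)
qed

end

theory Submission
  imports Defs "HOL-Computational_Algebra.Fundamental_Theorem_Algebra"
begin

text \<open>
  Along a solution put \<open>v = x'\<close>. Then \<open>\<langle>y, x\<rangle>' = \<langle>v, P v\<rangle> + 2 \<langle>v, Q x\<rangle> + \<langle>x, R x\<rangle> - \<lambda> |x|\<^sup>2\<close>, and for very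
  negative \<open>\<lambda>\<close> this dominates, up to a small factor \<open>\<delta>\<close>, the derivative of
  \<open>(2 t / T - 1) |x|\<^sup>2\<close>. In the coordinates \<open>a = (-y(0), y(T))\<close>, \<open>b = (x(0), x(T))\<close> of the graph this
  gives \<open>|b|\<^sup>2 \<le> \<delta> \<langle>a, b\<rangle>\<close>. Since \<open>\<U> (a - i b) = a + i b\<close>, it follows that \<open>|\<U> w - w| \<le> 2 \<delta> |w|\<close>, which is
  the limit, and the positivity of \<open>\<langle>a, b\<rangle>\<close> puts every eigenvalue of \<open>\<U>\<close> into the open upper half
  circle. So each of the \<open>2 n\<close> eigenvalue angles leaves a multiple of \<open>2 \<pi>\<close> upwards and contributes 1 to
  the index.
\<close>

section \<open>Continuous matrix coefficients\<close>

text \<open>\<open>maslov\<close> is a definite description, so some continuous choice of angles has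
  to exist and every choice has to give the same index. Both follow from the position of the
  eigenvalues: along the path they stay in the closed upper half circle, where the principal
  arguments, sorted, form a uniquely determined vector with entries in \<open>{0..pi}\<close>. A
  uniquely determined vector in a compact box that satisfies closed conditions varies continuously,
  so neither a lifting argument nor perturbation theory enters. The topology is defined through
  \<open>lag_U\<close>, not through frames. Limits are therefore taken of
  \<open>lag_U L *v w\<close> for a fixed \<open>w\<close>, which is represented by a point of
  \<open>L\<close>. The bound on \<open>|b|\<^sup>2\<close> needs both boundary terms with the same
  sign; the weight \<open>2 t / T - 1\<close> is the linear function that arranges this. That bound
  gives no strict positivity when \<open>b = 0\<close>, which is the case that would permit the
  eigenvalue 1; strictness has its own argument. For finite \<lambda>, continuity of the path rests
  on a Gronwall estimate for the difference of two solutions.\<close>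

lemma H1_on_imp_continuous_on:
  fixes f :: "real \<Rightarrow> 'a::euclidean_space"
  assumes "H1_on T f"
  shows "continuous_on {0..T} f"
proof -
  obtain g where m: "set_borel_measurable lebesgue {0..T} g"
    and i: "set_integrable lebesgue {0..T} (\<lambda>t. (norm (g t))\<^sup>2)"
    and f: "\<And>t. t \<in> {0..T} \<Longrightarrow> f t = f 0 + (LINT s:{0..t}|lebesgue. g s)"
    using assms unfolding H1_on_def by blast
  have "integrable lebesgue (indicat_real {0..T})"
    by (rule lmeasurable_iff_integrable[THEN iffD1]) (rule lmeasurable_interval)
  \<comment> \<open>The interval is bounded, so the constant 1 is integrable, and
    \<open>s \<le> 1 + s\<^sup>2\<close> dominates \<open>norm (g t)\<close> by an integrable
    function.\<close>
  then have "set_integrable lebesgue {0..T} (\<lambda>t. 1 + (norm (g t))\<^sup>2)"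
    using i by (intro set_integral_add) (auto simp: set_integrable_def)
  then have gi: "set_integrable lebesgue {0..T} g"
  proof (rule set_integrable_bound[OF _ m])
    show "AE x in lebesgue. x \<in> {0..T} \<longrightarrow> norm (g x) \<le> norm (1 + (norm (g x))\<^sup>2)"
    proof (intro AE_I2 impI)
      fix x
      have "0 \<le> (norm (g x) - 1)\<^sup>2" by simp
      then show "norm (g x) \<le> norm (1 + (norm (g x))\<^sup>2)"
        unfolding power2_diff by (simp add: abs_if)
    qed
  qed
  have "continuous_on {0..T} (\<lambda>t. f 0 + integral {0..t} g)"
    using set_lebesgue_integral_eq_integral(1)[OF gi]
    by (intro continuous_intros indefinite_integral_continuous_1)
  moreover have "f 0 + integral {0..t} g = f t" if "t \<in> {0..T}" for t
  proof -
    have "set_integrable lebesgue {0..t} g"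
      using that by (intro set_integrable_subset[OF gi]) auto
    then show ?thesis using f[OF that] set_lebesgue_integral_eq_integral(2) by metis
  qed
  ultimately show ?thesis by (rule continuous_on_eq)
qed

section \<open>Scalar inequalities: mean value, Gronwall, binary quadratic forms\<close>

lemma mvt_within:
  fixes f f' :: "real \<Rightarrow> real"
  assumes "a \<le> b" "\<And>t. t \<in> {a..b} \<Longrightarrow> (f has_vector_derivative f' t) (at t within {a..b})"
  shows "\<exists>t\<in>{a..b}. f b - f a = f' t * (b - a)"
  using mvt_very_simple[of a b f "\<lambda>t x. x *\<^sub>R f' t"] assms
  by (auto simp: has_vector_derivative_def mult.commute)

text \<open>Gronwall's inequality: multiplied by the integrating factor
  \<open>exp (- K * t)\<close>, \<open>f\<close> has a nonpositive derivative.\<close>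

lemma exp_growth:
  fixes f f' :: "real \<Rightarrow> real"
  assumes "0 \<le> T"
    and d: "\<And>t. t \<in> {0..T} \<Longrightarrow> (f has_vector_derivative f' t) (at t within {0..T})"
    and le: "\<And>t. t \<in> {0..T} \<Longrightarrow> f' t \<le> K * f t"
    and t: "t \<in> {0..T}"
  shows "f t \<le> exp (K * t) * f 0"
proof -
  let ?g = "\<lambda>t. exp (- K * t) * f t"
  have "\<exists>s\<in>{0..t}. ?g t - ?g 0 = (exp (- K * s) * (f' s - K * f s)) * (t - 0)"
  proof (rule mvt_within)
    fix s assume s: "s \<in> {0..t}"
    have "(f has_vector_derivative f' s) (at s within {0..t})"
      using s t by (intro has_vector_derivative_within_subset[OF d]) auto
    then show "(?g has_vector_derivative exp (- K * s) * (f' s - K * f s)) (at s within {0..t})"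
      unfolding has_real_derivative_iff_has_vector_derivative[symmetric]
      by (auto intro!: derivative_eq_intros simp: algebra_simps)
  qed (use t in auto)
  moreover have "exp (- K * s) * (f' s - K * f s) * t \<le> 0" if "s \<in> {0..t}" for s
    using le[of s] that t by (intro mult_nonpos_nonneg mult_nonneg_nonpos) auto
  ultimately have "?g t \<le> f 0" by fastforce
  then have "exp (K * t) * ?g t \<le> exp (K * t) * f 0" by (intro mult_left_mono) auto
  then show ?thesis by (simp add: mult_exp_exp flip: mult.assoc)
qed

text \<open>Multiplication by \<open>p\<close> completes the square. Vector estimates are reduced to
  this scalar form by taking \<open>v\<close> and \<open>x\<close> to be norms.\<close>

lemma quadratic_form_nonneg:
  fixes p b c v x :: real
  assumes "p > 0" "b\<^sup>2 \<le> p * c"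
  shows "0 \<le> p * v\<^sup>2 - 2 * b * v * x + c * x\<^sup>2"
proof -
  have "p * (p * v\<^sup>2 - 2 * b * v * x + c * x\<^sup>2) = (p * v - b * x)\<^sup>2 + (p * c - b\<^sup>2) * x\<^sup>2"
    by (simp add: power2_eq_square algebra_simps)
  also have "\<dots> \<ge> 0" using assms by simp
  finally show ?thesis using assms by (simp add: zero_le_mult_iff)
qed

lemma quadratic_form_pos:
  fixes p b c v x :: real
  assumes "p > 0" "b\<^sup>2 < p * c" "v \<noteq> 0 \<or> x \<noteq> 0"
  shows "0 < p * v\<^sup>2 - 2 * b * v * x + c * x\<^sup>2"
proof -
  have eq: "p * (p * v\<^sup>2 - 2 * b * v * x + c * x\<^sup>2) = (p * v - b * x)\<^sup>2 + (p * c - b\<^sup>2) * x\<^sup>2"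
    by (simp add: power2_eq_square algebra_simps)
  have "(p * v - b * x)\<^sup>2 + (p * c - b\<^sup>2) * x\<^sup>2 > 0"
  proof (cases "x = 0")
    case True then show ?thesis using assms by simp
  next
    case False
    then have "(p * c - b\<^sup>2) * x\<^sup>2 > 0" using assms by simp
    then show ?thesis by (smt (verit) zero_le_power2)
  qed
  then show ?thesis using assms(1) unfolding eq[symmetric] by (simp add: zero_less_mult_iff)
qed

section \<open>Bounds for matrix coefficients, uniform in time\<close>

lemma inner_transpose_matrix_vector:
  "(transpose A *v x) \<bullet> y = x \<bullet> (A *v (y :: real^'n))"
  by (simp add: transpose_matrix_vector dot_lmul_matrix)

lemma bounded_bilinear_matrix_vector_mult:
  "bounded_bilinear ((*v) :: real^'n::finite^'m::finite \<Rightarrow> real^'n \<Rightarrow> real^'m)"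
  unfolding bilinear_conv_bounded_bilinear[symmetric] bilinear_def
  by (intro conjI allI linearI)
    (rule matrix_vector_right_distrib matrix_vector_mult_scaleR matrix_vector_mult_add_rdistrib
      scaleR_matrix_vector_assoc[symmetric])+

lemma matrix_norm_bound:
  fixes A :: "real \<Rightarrow> real^'n::finite^'m::finite"
  assumes "continuous_on {0..T} A"
  obtains c where "c \<ge> 0" "\<And>t v. t \<in> {0..T} \<Longrightarrow> norm (A t *v v) \<le> c * norm v"
proof -
  have "bounded (A ` {0..T})"
    using compact_continuous_image[OF assms] compact_imp_bounded by blast
  then obtain c where c: "\<And>t. t \<in> {0..T} \<Longrightarrow> norm (A t) \<le> c"
    unfolding bounded_iff by (metis imageI)
  obtain K where K: "K > 0" "\<forall>(B :: real^'n^'m) v. norm (B *v v) \<le> norm B * norm v * K"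
    using bounded_bilinear.pos_bounded[OF bounded_bilinear_matrix_vector_mult] by (elim exE conjE)
  show thesis
  proof
    \<comment> \<open>\<open>c\<close> may be negative when \<open>{0..T}\<close> is empty, hence
      the absolute value.\<close>
    show "0 \<le> \<bar>c\<bar> * K" using K(1) by simp
    fix t and v :: "real^'n" assume "t \<in> {0..T}"
    then have "norm (A t) \<le> \<bar>c\<bar>" using c[of t] by linarith
    then have "norm (A t) * (norm v * K) \<le> \<bar>c\<bar> * (norm v * K)"
      using K(1) by (intro mult_right_mono) auto
    moreover have "norm (A t *v v) \<le> norm (A t) * norm v * K" using K(2) by blast
    ultimately show "norm (A t *v v) \<le> \<bar>c\<bar> * K * norm v"
      by (simp add: mult.assoc mult.left_commute mult.commute)
  qed
qed

text \<open>The constant is the minimum of the quadratic form over the compact set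
  \<open>{0..T} \<times> sphere 0 1\<close>; homogeneity carries the bound from unit vectors to all
  vectors.\<close>

lemma uniformly_positive_definite:
  fixes A :: "real \<Rightarrow> real^'n::finite^'n"
  assumes "continuous_on {0..T} A" "\<And>t. t \<in> {0..T} \<Longrightarrow> positive_definite (A t)"
  obtains c where "c > 0" "\<And>t v. t \<in> {0..T} \<Longrightarrow> c * (norm v)\<^sup>2 \<le> v \<bullet> (A t *v v)"
proof (cases "T < 0")
  case True
  then show thesis using that[of 1] by auto
next
  case False
  let ?S = "{0..T} \<times> sphere (0::real^'n) 1"
  let ?f = "\<lambda>(t, v). v \<bullet> (A t *v v)"
  have "compact ?S" by (intro compact_Times) auto
  moreover have "?S \<noteq> {}"
  proof -
    have "axis undefined 1 \<in> sphere (0::real^'n) 1" by (simp add: norm_axis_1)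
    then have "(0, axis undefined 1) \<in> ?S" using False by auto
    then show ?thesis by blast
  qed
  moreover have "continuous_on ?S ?f"
  proof -
    have "continuous_on ?S (\<lambda>z. A (fst z))"
      by (intro continuous_on_compose2[OF assms(1)] continuous_intros) auto
    then have "continuous_on ?S (\<lambda>z. A (fst z) *v snd z)"
      by (rule bounded_bilinear.continuous_on[OF bounded_bilinear_matrix_vector_mult])
        (rule continuous_on_snd[OF continuous_on_id])
    then show ?thesis
      unfolding case_prod_beta
      by (rule continuous_on_inner[OF continuous_on_snd[OF continuous_on_id]])
  qed
  ultimately have "\<exists>z\<in>?S. \<forall>w\<in>?S. ?f z \<le> ?f w" by (rule continuous_attains_inf)
  then obtain z where z: "z \<in> ?S" "\<And>w. w \<in> ?S \<Longrightarrow> ?f z \<le> ?f w" by blast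
  show thesis
  proof (rule that)
    obtain s w where "z = (s, w)" "s \<in> {0..T}" "norm w = 1" using z(1) by auto
    moreover from this have "w \<noteq> 0" by auto
    ultimately show "?f z > 0" using assms(2)[of s] by (simp add: positive_definite_def)
    fix t and v :: "real^'n" assume t: "t \<in> {0..T}"
    show "?f z * (norm v)\<^sup>2 \<le> v \<bullet> (A t *v v)"
    proof (cases "v = 0")
      case False
      let ?w = "(1 / norm v) *\<^sub>R v"
      have "?f z \<le> ?f (t, ?w)" using False t by (intro z(2)) auto
      also have "\<dots> = (v \<bullet> (A t *v v)) / (norm v)\<^sup>2"
        by (simp add: matrix_vector_mult_scaleR power2_eq_square)
      finally show ?thesis using False by (simp add: field_simps)
    qed simp
  qed
qed

section \<open>Solutions of the Sturm--Liouville system\<close>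

lemma norm_vjoin: "(norm (vjoin a b :: ('a::real_inner)^('m::finite + 'k::finite)))\<^sup>2 = (norm a)\<^sup>2 + (norm b)\<^sup>2"
  by (simp add: power2_norm_eq_inner inner_vec_def sum_UNIV_plus)

lemma bounded_linear_vfst: "bounded_linear (vfst :: real^('m::finite + 'k::finite) \<Rightarrow> _)"
  and bounded_linear_vsnd: "bounded_linear (vsnd :: real^('m::finite + 'k::finite) \<Rightarrow> _)"
  unfolding linear_conv_bounded_linear[symmetric]
  by (auto intro!: linearI simp: vfst_def vsnd_def vec_eq_iff)

text \<open>Carrying the velocity \<open>v\<close> along keeps the inverse of \<open>P\<close> out
  of the estimates. The forcing term \<open>h\<close> makes room for differences of solutions that
  belong to distinct spectral parameters.\<close>

definition sl_solution ::
    "(real \<Rightarrow> real^'n^'n) \<Rightarrow> (real \<Rightarrow> real^'n^'n) \<Rightarrow> (real \<Rightarrow> real^'n^'n) \<Rightarrow> real \<Rightarrow> real \<Rightarrow>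
      (real \<Rightarrow> real^'n) \<Rightarrow> (real \<Rightarrow> real^'n) \<Rightarrow> (real \<Rightarrow> real^'n::finite) \<Rightarrow> (real \<Rightarrow> real^'n) \<Rightarrow> bool" where
  "sl_solution P Q R T l h y x v \<longleftrightarrow> (\<forall>t\<in>{0..T}.
     (y has_vector_derivative transpose (Q t) *v v t + R t *v x t - l *\<^sub>R x t + h t) (at t within {0..T}) \<and>
     (x has_vector_derivative v t) (at t within {0..T}) \<and>
     y t = P t *v v t + Q t *v x t)"

lemma sl_solutionD:
  assumes "sl_solution P Q R T l h y x v" "t \<in> {0..T}"
  shows "(y has_vector_derivative transpose (Q t) *v v t + R t *v x t - l *\<^sub>R x t + h t) (at t within {0..T})"
    "(x has_vector_derivative v t) (at t within {0..T})"
    "y t = P t *v v t + Q t *v x t"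
  using assms unfolding sl_solution_def by auto

text \<open>From \<open>- l x + m x' = - l (x - x') + (m - l) x'\<close>: a change of the parameter
  turns into a forcing term proportional to \<open>m - l\<close>.\<close>

lemma sl_solution_diff:
  assumes "sl_solution P Q R T l (\<lambda>t. 0) y x v" "sl_solution P Q R T m (\<lambda>t. 0) y' x' v'"
  shows "sl_solution P Q R T l (\<lambda>t. (m - l) *\<^sub>R x' t)
    (\<lambda>t. y t - y' t) (\<lambda>t. x t - x' t) (\<lambda>t. v t - v' t)"
  unfolding sl_solution_def
proof (intro ballI conjI)
  fix t assume t: "t \<in> {0..T}"
  note s = sl_solutionD[OF assms(1) t] and s' = sl_solutionD[OF assms(2) t]
  show "((\<lambda>t. y t - y' t) has_vector_derivative transpose (Q t) *v (v t - v' t) + R t *v (x t - x' t)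
      - l *\<^sub>R (x t - x' t) + (m - l) *\<^sub>R x' t) (at t within {0..T})"
    using has_vector_derivative_diff[OF s(1) s'(1)]
    by (simp add: matrix_vector_mult_diff_distrib algebra_simps)
  show "((\<lambda>t. x t - x' t) has_vector_derivative v t - v' t) (at t within {0..T})"
    by (rule has_vector_derivative_diff[OF s(2) s'(2)])
  show "y t - y' t = P t *v (v t - v' t) + Q t *v (x t - x' t)"
    unfolding s(3) s'(3) by (simp add: matrix_vector_mult_diff_distrib algebra_simps)
qed

text \<open>The coefficients enter the estimates through the constants \<open>p\<close>,
  \<open>q\<close>, \<open>r\<close>, uniform in \<open>t\<close>, so that thresholds for
  \<open>l\<close> and growth rates become explicit.\<close>

locale sturm_liouville =
  fixes P Q R :: "real \<Rightarrow> real^'n::finite^'n" and T p q r :: real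
  assumes T: "T > 0" and p: "p > 0" and q: "q \<ge> 0" and r: "r \<ge> 0"
    and sym: "\<And>t. t \<in> {0..T} \<Longrightarrow> transpose (P t) = P t" "\<And>t. t \<in> {0..T} \<Longrightarrow> transpose (R t) = R t"
    and P_ge: "\<And>t v. t \<in> {0..T} \<Longrightarrow> p * (norm v)\<^sup>2 \<le> v \<bullet> (P t *v v)"
    and Q_le: "\<And>t v. t \<in> {0..T} \<Longrightarrow> norm (Q t *v v) \<le> q * norm v"
    and R_le: "\<And>t v. t \<in> {0..T} \<Longrightarrow> norm (R t *v v) \<le> r * norm v"
begin

abbreviation "sol l \<equiv> sl_solution P Q R T l (\<lambda>t. 0)"

text \<open>Lagrange's identity: the derivative of the symplectic pairing of two solutions with the
  same \<open>l\<close> vanishes, the terms cancelling in pairs by the symmetry of \<open>P\<close>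
  and \<open>R\<close>. This is what makes the flow symplectic.\<close>

lemma solution_symplectic:
  assumes s: "sol l y x v" and s': "sol l y' x' v'" and t: "t \<in> {0..T}"
  shows "y t \<bullet> x' t - x t \<bullet> y' t = y 0 \<bullet> x' 0 - x 0 \<bullet> y' 0"
proof -
  let ?f = "\<lambda>t. y t \<bullet> x' t - x t \<bullet> y' t"
  have "\<exists>s\<in>{0..t}. ?f t - ?f 0 = 0 * (t - 0)"
  proof (rule mvt_within)
    fix \<tau> assume \<tau>: "\<tau> \<in> {0..t}"
    then have \<tau>': "\<tau> \<in> {0..T}" using t by auto
    note d = sl_solutionD[OF s \<tau>'] and d' = sl_solutionD[OF s' \<tau>']
    have "(?f has_vector_derivative
       (y \<tau> \<bullet> v' \<tau> + (transpose (Q \<tau>) *v v \<tau> + R \<tau> *v x \<tau> - l *\<^sub>R x \<tau> + 0) \<bullet> x' \<tau>)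
       - (x \<tau> \<bullet> (transpose (Q \<tau>) *v v' \<tau> + R \<tau> *v x' \<tau> - l *\<^sub>R x' \<tau> + 0) + v \<tau> \<bullet> y' \<tau>)) (at \<tau> within {0..T})"
      by (intro has_vector_derivative_diff bounded_bilinear.has_vector_derivative[OF bounded_bilinear_inner] d d')
    moreover have "(y \<tau> \<bullet> v' \<tau> + (transpose (Q \<tau>) *v v \<tau> + R \<tau> *v x \<tau> - l *\<^sub>R x \<tau> + 0) \<bullet> x' \<tau>)
       - (x \<tau> \<bullet> (transpose (Q \<tau>) *v v' \<tau> + R \<tau> *v x' \<tau> - l *\<^sub>R x' \<tau> + 0) + v \<tau> \<bullet> y' \<tau>) = 0"
    proof -
      have "(R \<tau> *v x \<tau>) \<bullet> x' \<tau> = x \<tau> \<bullet> (R \<tau> *v x' \<tau>)"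
        using inner_transpose_matrix_vector[of "R \<tau>" "x \<tau>" "x' \<tau>"] sym(2)[OF \<tau>'] by simp
      moreover have "(P \<tau> *v v \<tau>) \<bullet> v' \<tau> = v \<tau> \<bullet> (P \<tau> *v v' \<tau>)"
        using inner_transpose_matrix_vector[of "P \<tau>" "v \<tau>" "v' \<tau>"] sym(1)[OF \<tau>'] by simp
      moreover have "x \<tau> \<bullet> (transpose (Q \<tau>) *v v' \<tau>) = v' \<tau> \<bullet> (Q \<tau> *v x \<tau>)"
        by (metis inner_commute inner_transpose_matrix_vector)
      moreover have "(transpose (Q \<tau>) *v v \<tau>) \<bullet> x' \<tau> = v \<tau> \<bullet> (Q \<tau> *v x' \<tau>)"
        by (rule inner_transpose_matrix_vector)
      ultimately show ?thesis
        by (simp add: d(3) d'(3) inner_add_left inner_add_right inner_diff_left inner_diff_right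
            inner_commute[of "Q \<tau> *v x \<tau>"])
    qed
    ultimately have "(?f has_vector_derivative 0) (at \<tau> within {0..T})" by simp
    then show "(?f has_vector_derivative 0) (at \<tau> within {0..t})"
      using t by (rule_tac has_vector_derivative_within_subset) auto
  qed (use t in auto)
  then show ?thesis by auto
qed

section \<open>Lower bounds for the boundary form at very negative parameters\<close>

text \<open>Twice the Lagrangian density of the variational problem whose Euler-Lagrange equation is
  the system with parameter \<open>l\<close>.\<close>

definition action :: "real \<Rightarrow> real \<Rightarrow> real^'n \<Rightarrow> real^'n \<Rightarrow> real" where
  "action l t x v = v \<bullet> (P t *v v) + 2 * (v \<bullet> (Q t *v x)) + x \<bullet> (R t *v x) - l * (norm x)\<^sup>2"

lemma boundary_derivative:
  assumes "sol l y x v" "t \<in> {0..T}"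
  shows "((\<lambda>t. y t \<bullet> x t) has_vector_derivative action l t (x t) (v t)) (at t within {0..T})"
proof -
  note d = sl_solutionD[OF assms]
  have "((\<lambda>t. y t \<bullet> x t) has_vector_derivative
      y t \<bullet> v t + (transpose (Q t) *v v t + R t *v x t - l *\<^sub>R x t + 0) \<bullet> x t) (at t within {0..T})"
    by (intro bounded_bilinear.has_vector_derivative[OF bounded_bilinear_inner] d)
  moreover have "(transpose (Q t) *v v t) \<bullet> x t = v t \<bullet> (Q t *v x t)"
    by (rule inner_transpose_matrix_vector)
  ultimately show ?thesis
    by (simp add: d(3) action_def inner_add_left inner_diff_left inner_commute power2_norm_eq_inner algebra_simps)
qed

lemma action_ge:
  assumes "t \<in> {0..T}"
  shows "p * (norm v)\<^sup>2 - 2 * q * norm v * norm x + (- r - l) * (norm x)\<^sup>2 \<le> action l t x v"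
proof -
  have "- (norm v * (q * norm x)) \<le> v \<bullet> (Q t *v x)"
  proof -
    have "\<bar>v \<bullet> (Q t *v x)\<bar> \<le> norm v * norm (Q t *v x)" by (rule Cauchy_Schwarz_ineq2)
    also have "\<dots> \<le> norm v * (q * norm x)" by (intro mult_left_mono Q_le assms) auto
    finally show ?thesis by linarith
  qed
  moreover have "- (norm x * (r * norm x)) \<le> x \<bullet> (R t *v x)"
  proof -
    have "\<bar>x \<bullet> (R t *v x)\<bar> \<le> norm x * norm (R t *v x)" by (rule Cauchy_Schwarz_ineq2)
    also have "\<dots> \<le> norm x * (r * norm x)" by (intro mult_left_mono R_le assms) auto
    finally show ?thesis by linarith
  qed
  ultimately show ?thesis
    using P_ge[OF assms, of v] by (simp add: action_def power2_eq_square algebra_simps)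
qed

text \<open>The hypothesis \<open>b\<^sup>2 \<le> p * c\<close> of
  \<open>quadratic_form_nonneg\<close>, solved for \<open>l\<close>, with the coefficients
  \<open>\<delta> * p\<close>, \<open>\<delta> * q + 1\<close> and
  \<open>\<delta> * (- r - l) - 2 / T\<close> that occur in
  \<open>boundary_estimate\<close>.\<close>

definition threshold :: "real \<Rightarrow> real" where
  "threshold \<delta> = - (r + 2 / (T * \<delta>) + (\<delta> * q + 1)\<^sup>2 / (\<delta>\<^sup>2 * p))"

lemma threshold_iff:
  assumes "\<delta> > 0"
  shows "l \<le> threshold \<delta> \<longleftrightarrow> (\<delta> * q + 1)\<^sup>2 \<le> \<delta> * p * (\<delta> * (- r - l) - 2 / T)"
proof -
  have "l \<le> threshold \<delta> \<longleftrightarrow> (\<delta> * q + 1)\<^sup>2 / (\<delta>\<^sup>2 * p) \<le> - r - l - 2 / (T * \<delta>)"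
    unfolding threshold_def by linarith
  also have "\<dots> \<longleftrightarrow> (\<delta> * q + 1)\<^sup>2 \<le> (- r - l - 2 / (T * \<delta>)) * (\<delta>\<^sup>2 * p)"
    using assms p by (simp add: pos_divide_le_eq)
  also have "(- r - l - 2 / (T * \<delta>)) * (\<delta>\<^sup>2 * p) = \<delta> * p * (\<delta> * (- r - l) - 2 / T)"
    using assms T by (simp add: field_simps power2_eq_square)
  finally show ?thesis .
qed

text \<open>The weight \<open>2 t / T - 1\<close> runs from \<open>-1\<close> to \<open>1\<close>, so that \<open>(2 t / T - 1) |x|\<^sup>2\<close> telescopes to
  \<open>|x(0)|\<^sup>2 + |x(T)|\<^sup>2\<close>; for very negative \<open>l\<close> its derivative is dominated by that of
  \<open>\<delta> \<langle>y, x\<rangle>\<close>.\<close>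

lemma boundary_estimate:
  assumes s: "sol l y x v" and \<delta>: "\<delta> > 0" and l: "l \<le> threshold \<delta>"
  shows "(norm (x 0))\<^sup>2 + (norm (x T))\<^sup>2 \<le> \<delta> * (y T \<bullet> x T - y 0 \<bullet> x 0)"
proof -
  let ?w = "\<lambda>t. 2 * t / T - 1"
  let ?f = "\<lambda>t. \<delta> * (y t \<bullet> x t) - ?w t * (x t \<bullet> x t)"
  let ?f' = "\<lambda>t. \<delta> * action l t (x t) (v t) - (?w t * (x t \<bullet> v t + v t \<bullet> x t) + 2 / T * (x t \<bullet> x t))"
  have "\<exists>t\<in>{0..T}. ?f T - ?f 0 = ?f' t * (T - 0)"
  proof (rule mvt_within)
    fix t assume t: "t \<in> {0..T}"
    have "(?w has_vector_derivative 2 / T) (at t within {0..T})"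
      unfolding has_real_derivative_iff_has_vector_derivative[symmetric]
      using T by (auto intro!: derivative_eq_intros)
    then show "(?f has_vector_derivative ?f' t) (at t within {0..T})"
      by (intro has_vector_derivative_diff has_vector_derivative_mult boundary_derivative[OF s t]
          bounded_bilinear.has_vector_derivative[OF bounded_bilinear_inner] sl_solutionD(2)[OF s t]
          has_vector_derivative_mult_right)
  qed (use T in auto)
  moreover have "0 \<le> ?f' t" if t: "t \<in> {0..T}" for t
  proof -
    let ?V = "norm (v t)" and ?X = "norm (x t)"
    have w: "\<bar>?w t\<bar> \<le> 1" using t T by (auto simp: abs_le_iff field_simps)
    have "?w t * (x t \<bullet> v t + v t \<bullet> x t) \<le> \<bar>?w t\<bar> * \<bar>x t \<bullet> v t + v t \<bullet> x t\<bar>"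
      unfolding abs_mult[symmetric] by (rule abs_ge_self)
    also have "\<dots> \<le> 1 * (2 * (?X * ?V))"
      using w Cauchy_Schwarz_ineq2[of "x t" "v t"] by (intro mult_mono) (auto simp: inner_commute)
    finally have 1: "?w t * (x t \<bullet> v t + v t \<bullet> x t) \<le> 2 * (?X * ?V)" by simp
    have "\<delta> * (p * ?V\<^sup>2 - 2 * q * ?V * ?X + (- r - l) * ?X\<^sup>2) \<le> \<delta> * action l t (x t) (v t)"
      using \<delta> action_ge[OF t] by (intro mult_left_mono) auto
    \<comment> \<open>The \<open>+ 1\<close> pays for the cross term \<open>2 * (?X * ?V)\<close>
      produced by the weight, the \<open>- 2 / T\<close> for the slope of the weight.\<close>
    moreover have "0 \<le> (\<delta> * p) * ?V\<^sup>2 - 2 * (\<delta> * q + 1) * ?V * ?X + (\<delta> * (- r - l) - 2 / T) * ?X\<^sup>2"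
      using l p \<delta> threshold_iff[OF \<delta>] by (intro quadratic_form_nonneg) (auto simp: mult_ac)
    ultimately show ?thesis using 1 unfolding dot_square_norm by (simp add: algebra_simps)
  qed
  ultimately have "?f 0 \<le> ?f T" using T by (smt (verit) mult_nonneg_nonneg)
  then show ?thesis using T by (simp add: dot_square_norm algebra_simps)
qed

text \<open>When \<open>x 0 = x T = 0\<close>, \<open>boundary_estimate\<close> yields only
  nonnegativity. Strictness comes from the mean value theorem: the form is \<open>T\<close> times
  the action at some time, and there \<open>v\<close> and \<open>x\<close> cannot both vanish, since
  otherwise \<open>y = P v + Q x\<close> would vanish with \<open>x\<close>.\<close>

lemma boundary_form_pos:
  assumes s: "sol l y x v" and l: "l \<le> threshold 1"
    and nz: "\<And>t. t \<in> {0..T} \<Longrightarrow> y t \<noteq> 0 \<or> x t \<noteq> 0"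
  shows "0 < y T \<bullet> x T - y 0 \<bullet> x 0"
proof -
  have "\<exists>t\<in>{0..T}. y T \<bullet> x T - y 0 \<bullet> x 0 = action l t (x t) (v t) * (T - 0)"
    using T by (intro mvt_within boundary_derivative[OF s]) auto
  then obtain t where t: "t \<in> {0..T}" "y T \<bullet> x T - y 0 \<bullet> x 0 = action l t (x t) (v t) * T" by auto
  have "v t \<noteq> 0 \<or> x t \<noteq> 0" using nz[OF t(1)] sl_solutionD(3)[OF s t(1)] by auto
  moreover have "q\<^sup>2 < p * (- r - l)"
  proof -
    have "(q + 1)\<^sup>2 \<le> p * (- r - l - 2 / T)" using l threshold_iff[of 1 l] by simp
    also have "\<dots> \<le> p * (- r - l)" using T p by (intro mult_left_mono) auto
    finally show ?thesis using q by (simp add: power2_eq_square algebra_simps)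
  qed
  ultimately have "0 < p * (norm (v t))\<^sup>2 - 2 * q * norm (v t) * norm (x t) + (- r - l) * (norm (x t))\<^sup>2"
    using p by (intro quadratic_form_pos) auto
  also have "\<dots> \<le> action l t (x t) (v t)" by (rule action_ge[OF t(1)])
  finally show ?thesis using t(2) T by simp
qed

section \<open>Growth of solutions and their dependence on the parameter\<close>

text \<open>\<open>(1 + q) / p\<close> bounds the velocity relative to the norm of
  \<open>(y, x)\<close>; the summands in the parenthesis come from the terms with \<open>Q\<close>,
  \<open>R\<close> and \<open>l\<close> in \<open>y'\<close> and from \<open>x' = v\<close>. The
  final \<open>+ 1\<close> pays for the forcing.\<close>

definition growth_rate :: "real \<Rightarrow> real" where
  "growth_rate L = 2 * ((1 + q) / p * q + r + L + (1 + q) / p) + 1"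

text \<open>Adding the constant \<open>m\<^sup>2\<close> to the energy turns the inhomogeneous
  inequality into \<open>f' \<le> K * f\<close>, to which \<open>exp_growth\<close> applies: the
  forcing contributes \<open>2 N m \<le> N\<^sup>2 + m\<^sup>2\<close>, and
  \<open>K \<ge> 1\<close>.\<close>

lemma solution_growth:
  assumes s: "sl_solution P Q R T l h y x v"
    and l: "\<bar>l\<bar> \<le> L" and h: "\<And>t. t \<in> {0..T} \<Longrightarrow> norm (h t) \<le> m" and t: "t \<in> {0..T}"
  shows "(norm (y t))\<^sup>2 + (norm (x t))\<^sup>2 \<le> exp (growth_rate L * T) * ((norm (y 0))\<^sup>2 + (norm (x 0))\<^sup>2 + m\<^sup>2)"
proof -
  let ?K = "growth_rate L" and ?a = "(1 + q) / p"
  let ?f = "\<lambda>t. y t \<bullet> y t + x t \<bullet> x t + m\<^sup>2"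
  let ?y' = "\<lambda>t. transpose (Q t) *v v t + R t *v x t - l *\<^sub>R x t + h t"
  have K: "?K \<ge> 1" using p q r l by (simp add: growth_rate_def)
  have m: "m \<ge> 0" using h[of 0] T by (auto intro: order_trans[OF norm_ge_zero])
  have "?f t \<le> exp (?K * t) * ?f 0"
  proof (rule exp_growth[where f' = "\<lambda>t. (y t \<bullet> ?y' t + ?y' t \<bullet> y t) + (x t \<bullet> v t + v t \<bullet> x t) + 0" and T = T])
    fix t assume t: "t \<in> {0..T}"
    note d = sl_solutionD[OF s t]
    show "(?f has_vector_derivative (y t \<bullet> ?y' t + ?y' t \<bullet> y t) + (x t \<bullet> v t + v t \<bullet> x t) + 0) (at t within {0..T})"
      by (intro has_vector_derivative_add bounded_bilinear.has_vector_derivative[OF bounded_bilinear_inner] d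
          has_vector_derivative_const)
    let ?N = "sqrt ((norm (y t))\<^sup>2 + (norm (x t))\<^sup>2)"
    have N: "norm (y t) \<le> ?N" "norm (x t) \<le> ?N" "?N \<ge> 0" by (auto intro: real_le_rsqrt)
    \<comment> \<open>Coercivity of \<open>P\<close> gives
      \<open>p |v|\<^sup>2 \<le> \<langle>v, y - Q x\<rangle>\<close>; Cauchy-Schwarz and division
      by \<open>|v|\<close> then bound the velocity.\<close>
    have v: "norm (v t) \<le> ?a * ?N"
    proof -
      have Pv: "P t *v v t = y t - Q t *v x t" by (simp add: d(3))
      have "p * (norm (v t))\<^sup>2 \<le> v t \<bullet> (y t - Q t *v x t)" using P_ge[OF t, of "v t"] Pv by simp
      also have "\<dots> \<le> norm (v t) * norm (y t - Q t *v x t)" by (rule norm_cauchy_schwarz)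
      also have "\<dots> \<le> norm (v t) * (?N + q * ?N)"
      proof (intro mult_left_mono)
        have "norm (y t - Q t *v x t) \<le> norm (y t) + norm (Q t *v x t)" by (rule norm_triangle_ineq4)
        also have "\<dots> \<le> ?N + q * norm (x t)" by (intro add_mono N Q_le t)
        also have "\<dots> \<le> ?N + q * ?N" by (intro add_left_mono mult_left_mono N q)
        finally show "norm (y t - Q t *v x t) \<le> ?N + q * ?N" .
      qed auto
      finally have "norm (v t) * (p * norm (v t)) \<le> norm (v t) * ((1 + q) * ?N)"
        by (simp add: power2_eq_square algebra_simps)
      then have "p * norm (v t) \<le> (1 + q) * ?N" using N(3) q by (cases "v t = 0") auto
      then show ?thesis using p by (simp add: field_simps)
    qed
    have xv: "x t \<bullet> v t \<le> ?N * (?a * ?N)"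
      by (rule order_trans[OF norm_cauchy_schwarz]) (intro mult_mono N v; simp)
    have yy: "y t \<bullet> ?y' t \<le> ?a * ?N * (q * ?N) + ?N * (r * ?N) + ?N * (L * ?N) + ?N * m"
    proof -
      have "y t \<bullet> (transpose (Q t) *v v t) = v t \<bullet> (Q t *v y t)"
        by (metis inner_commute inner_transpose_matrix_vector)
      also have "\<dots> \<le> norm (v t) * norm (Q t *v y t)" by (rule norm_cauchy_schwarz)
      also have "\<dots> \<le> ?a * ?N * (q * norm (y t))" using q by (intro mult_mono v Q_le t) (auto simp: p less_imp_le)
      also have "\<dots> \<le> ?a * ?N * (q * ?N)" using q p by (intro mult_left_mono N) auto
      finally have 1: "y t \<bullet> (transpose (Q t) *v v t) \<le> ?a * ?N * (q * ?N)" .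
      have "y t \<bullet> (R t *v x t) \<le> norm (y t) * norm (R t *v x t)" by (rule norm_cauchy_schwarz)
      also have "\<dots> \<le> ?N * (r * norm (x t))" by (intro mult_mono N R_le t) auto
      also have "\<dots> \<le> ?N * (r * ?N)" using r by (intro mult_left_mono N) auto
      finally have 2: "y t \<bullet> (R t *v x t) \<le> ?N * (r * ?N)" .
      have "- (y t \<bullet> (l *\<^sub>R x t)) \<le> norm (y t) * norm (l *\<^sub>R x t)"
        using Cauchy_Schwarz_ineq2[of "y t" "l *\<^sub>R x t"] by linarith
      also have "\<dots> \<le> ?N * (L * ?N)" using l by (auto intro!: mult_mono N)
      finally have 3: "- (y t \<bullet> (l *\<^sub>R x t)) \<le> ?N * (L * ?N)" .
      have "y t \<bullet> h t \<le> norm (y t) * norm (h t)" by (rule norm_cauchy_schwarz)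
      also have "\<dots> \<le> ?N * m" by (intro mult_mono N h t) auto
      finally have 4: "y t \<bullet> h t \<le> ?N * m" .
      show ?thesis using 1 2 3 4 by (simp add: inner_add_right inner_diff_right)
    qed
    have "(y t \<bullet> ?y' t + ?y' t \<bullet> y t) + (x t \<bullet> v t + v t \<bullet> x t) + 0 = 2 * (y t \<bullet> ?y' t) + 2 * (x t \<bullet> v t)"
      by (simp add: inner_commute)
    also have "\<dots> \<le> 2 * (?a * ?N * (q * ?N) + ?N * (r * ?N) + ?N * (L * ?N) + ?N * m) + 2 * (?N * (?a * ?N))"
      by (intro add_mono mult_left_mono xv yy) auto
    also have "\<dots> = (2 * (?a * q + r + L + ?a)) * ?N\<^sup>2 + 2 * (?N * m)"
    proof -
      have "2 * (a * N * (q * N) + N * (r * N) + N * (L * N) + N * m) + 2 * (N * (a * N))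
        = (2 * (a * q + r + L + a)) * N\<^sup>2 + 2 * (N * m)" for a N :: real
        by (simp add: power2_eq_square algebra_simps)
      then show ?thesis .
    qed
    also have "\<dots> \<le> (2 * (?a * q + r + L + ?a)) * ?N\<^sup>2 + (?N\<^sup>2 + m\<^sup>2)"
    proof -
      have "0 \<le> (?N - m)\<^sup>2" by simp
      then show ?thesis unfolding power2_diff by simp
    qed
    also have "\<dots> = ?K * ?N\<^sup>2 + m\<^sup>2" unfolding growth_rate_def by (simp only: distrib_right mult_1_left)
    also have "\<dots> \<le> ?K * ?N\<^sup>2 + ?K * m\<^sup>2" using K mult_right_mono[OF K, of "m\<^sup>2"] by simp
    also have "\<dots> = ?K * ?f t" by (simp add: dot_square_norm algebra_simps)
    finally show "(y t \<bullet> ?y' t + ?y' t \<bullet> y t) + (x t \<bullet> v t + v t \<bullet> x t) + 0 \<le> ?K * ?f t" .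
  qed (use T t in auto)
  also have "\<dots> \<le> exp (?K * T) * ?f 0" using K t by (intro mult_right_mono) auto
  finally show ?thesis unfolding dot_square_norm by (smt (verit) zero_le_power2)
qed

text \<open>\<open>solution_growth\<close> is applied twice, hence the squared exponential: first to
  \<open>x'\<close>, which bounds the forcing of the difference, then to the difference itself,
  whose initial value is zero.\<close>

lemma solution_lipschitz:
  assumes s: "sol l y x v" and s': "sol l' y' x' v'" and l: "\<bar>l\<bar> \<le> L" "\<bar>l'\<bar> \<le> L"
    and init: "y 0 = y' 0" "x 0 = x' 0" and t: "t \<in> {0..T}"
  shows "(norm (y t - y' t))\<^sup>2 + (norm (x t - x' t))\<^sup>2
    \<le> (exp (growth_rate L * T))\<^sup>2 * ((norm (y 0))\<^sup>2 + (norm (x 0))\<^sup>2) * (l - l')\<^sup>2"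
proof -
  let ?e = "exp (growth_rate L * T)" and ?m = "(norm (y 0))\<^sup>2 + (norm (x 0))\<^sup>2"
  have b: "norm ((l' - l) *\<^sub>R x' \<tau>) \<le> sqrt (?e * ?m * (l - l')\<^sup>2)" if \<tau>: "\<tau> \<in> {0..T}" for \<tau>
  proof -
    have "(norm (y' \<tau>))\<^sup>2 + (norm (x' \<tau>))\<^sup>2 \<le> ?e * ((norm (y' 0))\<^sup>2 + (norm (x' 0))\<^sup>2 + 0\<^sup>2)"
      by (rule solution_growth[OF s' l(2) _ \<tau>]) simp
    then have "(norm (x' \<tau>))\<^sup>2 \<le> ?e * ?m" using init by (smt (verit) zero_le_power2 power_zero_numeral)
    then have "(norm (x' \<tau>))\<^sup>2 * (l - l')\<^sup>2 \<le> ?e * ?m * (l - l')\<^sup>2" by (rule mult_right_mono) simp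
    moreover have "(norm ((l' - l) *\<^sub>R x' \<tau>))\<^sup>2 = (norm (x' \<tau>))\<^sup>2 * (l - l')\<^sup>2"
      by (simp add: power_mult_distrib power2_commute)
    ultimately show ?thesis by (intro real_le_rsqrt) simp
  qed
  have "(norm (y t - y' t))\<^sup>2 + (norm (x t - x' t))\<^sup>2
      \<le> ?e * ((norm (y 0 - y' 0))\<^sup>2 + (norm (x 0 - x' 0))\<^sup>2 + (sqrt (?e * ?m * (l - l')\<^sup>2))\<^sup>2)"
    by (rule solution_growth[OF sl_solution_diff[OF s s'] l(1) b t])
  also have "\<dots> = ?e\<^sup>2 * ?m * (l - l')\<^sup>2" by (simp add: init power2_eq_square)
  finally show ?thesis .
qed

end

section \<open>From the fundamental solution to the flow and its boundary form\<close>

lemma matrix_inv_right: "invertible (A :: 'a::semiring_1^'n^'n) \<Longrightarrow> A ** matrix_inv A = mat 1"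
  unfolding invertible_def matrix_inv_def by (rule someI2_ex) auto

lemma positive_definite_invertible: "positive_definite A \<Longrightarrow> invertible (A :: real^'n^'n)"
  unfolding invertible_left_inverse matrix_left_invertible_ker positive_definite_def
  by (metis inner_zero_right less_irrefl)

text \<open>The first block of \<open>B_mat P Q R l t *v vjoin y x\<close> is the velocity
  \<open>v\<close>, the second is minus the right-hand side of the equation for \<open>y\<close>;
  \<open>J_mat\<close> exchanges the blocks with the matching sign.\<close>

lemma fundamental_solution_imp_sl_solution:
  fixes u :: "real^('n::finite + 'n)"
  assumes Y: "fundamental_solution T (\<lambda>t. J_mat ** B_mat P Q R l t) Y"
    and P: "\<And>t. t \<in> {0..T} \<Longrightarrow> positive_definite (P t)"
  shows "sl_solution P Q R T l (\<lambda>t. 0) (\<lambda>t. vfst (Y t *v u)) (\<lambda>t. vsnd (Y t *v u))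
    (\<lambda>t. matrix_inv (P t) *v (vfst (Y t *v u) - Q t *v vsnd (Y t *v u)))"
  unfolding sl_solution_def
proof (intro ballI)
  fix t assume t: "t \<in> {0..T}"
  define y where "y = vfst (Y t *v u)"
  define x where "x = vsnd (Y t *v u)"
  define v where "v = matrix_inv (P t) *v (y - Q t *v x)"
  have z: "Y t *v u = vjoin y x" by (simp add: y_def x_def)
  have "bounded_linear (\<lambda>A :: real^('n + 'n)^('n + 'n). A *v u)"
    by (rule bounded_bilinear.bounded_linear_left[OF bounded_bilinear_matrix_vector_mult])
  moreover have "(Y has_vector_derivative (J_mat ** B_mat P Q R l t ** Y t)) (at t within {0..T})"
    using Y t by (simp add: fundamental_solution_def)
  ultimately have d: "((\<lambda>t. Y t *v u) has_vector_derivative (J_mat ** B_mat P Q R l t ** Y t) *v u) (at t within {0..T})"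
    by (rule bounded_linear.has_vector_derivative)
  have v_eq: "v = matrix_inv (P t) *v y - (matrix_inv (P t) ** Q t) *v x"
    by (simp add: v_def matrix_vector_mult_diff_distrib matrix_vector_mul_assoc)
  have neg: "(- A) *v w = - (A *v w)" for A :: "real^'n^'n" and w
    by (simp add: matrix_vector_mult_def vec_eq_iff sum_negf)
  have "B_mat P Q R l t *v vjoin y x
      = vjoin v (- (transpose (Q t) *v v) - R t *v x + l *\<^sub>R x)"
    unfolding B_mat_def blockmul vjoin_inj v_eq
    by (simp add: neg matrix_vector_mult_add_rdistrib matrix_vector_mult_diff_rdistrib
        matrix_vector_mult_diff_distrib matrix_vector_mul_assoc matrix_mul_assoc
        scaleR_matrix_vector_assoc[symmetric])
  then have "(J_mat ** B_mat P Q R l t ** Y t) *v u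
      = J_mat *v vjoin v (- (transpose (Q t) *v v) - R t *v x + l *\<^sub>R x)"
    by (simp only: matrix_vector_mul_assoc[symmetric] z)
  also have "\<dots> = vjoin (transpose (Q t) *v v + R t *v x - l *\<^sub>R x) v"
    unfolding J_mat_def blockmul vjoin_inj by (simp add: neg)
  finally have e: "(J_mat ** B_mat P Q R l t ** Y t) *v u = \<dots>" .
  have "P t *v v = y - Q t *v x"
    unfolding v_def matrix_vector_mul_assoc
      matrix_inv_right[OF positive_definite_invertible[OF P[OF t]]] by simp
  then show "((\<lambda>t. vfst (Y t *v u)) has_vector_derivative transpose (Q t) *v
         (matrix_inv (P t) *v (vfst (Y t *v u) - Q t *v vsnd (Y t *v u)))
         + R t *v vsnd (Y t *v u) - l *\<^sub>R vsnd (Y t *v u) + 0) (at t within {0..T}) \<and>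
       ((\<lambda>t. vsnd (Y t *v u)) has_vector_derivative
         matrix_inv (P t) *v (vfst (Y t *v u) - Q t *v vsnd (Y t *v u))) (at t within {0..T}) \<and>
       vfst (Y t *v u) = P t *v (matrix_inv (P t) *v (vfst (Y t *v u) - Q t *v vsnd (Y t *v u)))
         + Q t *v vsnd (Y t *v u)"
    using bounded_linear.has_vector_derivative[OF bounded_linear_vfst d]
      bounded_linear.has_vector_derivative[OF bounded_linear_vsnd d]
    unfolding e by (simp flip: x_def y_def v_def)
qed

text \<open>Equivalent to \<open>transpose M ** J_mat ** M = J_mat\<close>, but written in the
  components in which \<open>solution_symplectic\<close> delivers it.\<close>

definition symplectic :: "real^('n::finite + 'n)^('n + 'n) \<Rightarrow> bool" where
  "symplectic M \<longleftrightarrow> (\<forall>u w. vfst (M *v u) \<bullet> vsnd (M *v w) - vsnd (M *v u) \<bullet> vfst (M *v w)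
      = vfst u \<bullet> vsnd w - vsnd u \<bullet> vfst w)"

definition boundary_form :: "real^('n::finite + 'n)^('n + 'n) \<Rightarrow> real^('n + 'n) \<Rightarrow> real" where
  "boundary_form M u = vfst (M *v u) \<bullet> vsnd (M *v u) - vfst u \<bullet> vsnd u"

lemma norm_vfst_vsnd: "(norm (u :: real^('m::finite + 'k::finite)))\<^sup>2 = (norm (vfst u))\<^sup>2 + (norm (vsnd u))\<^sup>2"
  using norm_vjoin[of "vfst u" "vsnd u"] by simp

locale sturm_liouville_flow = sturm_liouville P Q R T p q r
  for P Q R :: "real \<Rightarrow> real^'n::finite^'n" and T p q r :: real +
  fixes \<gamma> :: "real \<Rightarrow> real \<Rightarrow> real^('n + 'n)^('n + 'n)"
  assumes posdef: "\<And>t. t \<in> {0..T} \<Longrightarrow> positive_definite (P t)"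
    and \<gamma>: "\<And>l. fundamental_solution T (\<lambda>t. J_mat ** B_mat P Q R l t) (\<gamma> l)"
begin

lemma flow_solution:
  "sol l (\<lambda>t. vfst (\<gamma> l t *v u)) (\<lambda>t. vsnd (\<gamma> l t *v u))
    (\<lambda>t. matrix_inv (P t) *v (vfst (\<gamma> l t *v u) - Q t *v vsnd (\<gamma> l t *v u)))"
  by (rule fundamental_solution_imp_sl_solution[OF \<gamma> posdef])

lemma flow_0: "\<gamma> l 0 *v u = u"
  using \<gamma>[of l] by (simp add: fundamental_solution_def)

lemma symplectic_flow: "t \<in> {0..T} \<Longrightarrow> symplectic (\<gamma> l t)"
  unfolding symplectic_def using solution_symplectic[OF flow_solution flow_solution] by (simp add: flow_0)

lemma flow_eq_0_iff:
  assumes "t \<in> {0..T}" shows "\<gamma> l t *v u = 0 \<longleftrightarrow> u = 0"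
proof
  assume 0: "\<gamma> l t *v u = 0"
  have "vfst (0 :: real^('n + 'n)) = 0" "vsnd (0 :: real^('n + 'n)) = 0"
    by (simp_all add: vfst_def vsnd_def vec_eq_iff)
  \<comment> \<open>Nondegeneracy of the symplectic form: it is tested against
    \<open>w = vjoin (- vsnd u) (vfst u)\<close>, which makes the pairing
    \<open>(norm u)\<^sup>2\<close>.\<close>
  then have "vfst u \<bullet> vfst u - vsnd u \<bullet> (- vsnd u) = 0"
    using symplectic_flow[OF assms, of l] 0 unfolding symplectic_def
    by (metis diff_self inner_zero_left vfst_vjoin)
  then have "(norm u)\<^sup>2 = 0" by (simp add: norm_vfst_vsnd dot_square_norm)
  then show "u = 0" by simp
qed simp

lemma flow_boundary_estimate:
  assumes "\<delta> > 0" "l \<le> threshold \<delta>"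
  shows "(norm (vsnd u))\<^sup>2 + (norm (vsnd (\<gamma> l T *v u)))\<^sup>2 \<le> \<delta> * boundary_form (\<gamma> l T) u"
  using boundary_estimate[OF flow_solution assms, of u] by (simp add: boundary_form_def flow_0)

lemma flow_boundary_form_pos:
  assumes "l \<le> threshold 1" "u \<noteq> 0"
  shows "0 < boundary_form (\<gamma> l T) u"
proof -
  have "vfst (\<gamma> l t *v u) \<noteq> 0 \<or> vsnd (\<gamma> l t *v u) \<noteq> 0" if "t \<in> {0..T}" for t
    using flow_eq_0_iff[OF that, of l u] assms(2) norm_vfst_vsnd[of "\<gamma> l t *v u"] by force
  from boundary_form_pos[OF flow_solution assms(1) this] show ?thesis
    by (simp add: boundary_form_def flow_0)
qed

lemma tendsto_flow: "((\<lambda>l. \<gamma> l T *v u) \<longlongrightarrow> \<gamma> l0 T *v u) (at l0)"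
proof -
  \<comment> \<open>Parameters at distance less than 1 from \<open>l0\<close> are bounded by
    \<open>\<bar>l0\<bar> + 1\<close>, so one Lipschitz constant serves all of them.\<close>
  let ?C = "(exp (growth_rate (\<bar>l0\<bar> + 1) * T))\<^sup>2 * (norm u)\<^sup>2"
  have "vfst (a - b) = vfst a - vfst b" "vsnd (a - b) = vsnd a - vsnd b" for a b :: "real^('n + 'n)"
    by (simp_all add: vfst_def vsnd_def vec_eq_iff)
  then have est: "(norm (\<gamma> l T *v u - \<gamma> l0 T *v u))\<^sup>2 \<le> ?C * (l - l0)\<^sup>2" if "\<bar>l - l0\<bar> < 1" for l
    using solution_lipschitz[OF flow_solution flow_solution, of l "\<bar>l0\<bar> + 1" l0 u u T] that T
    by (simp add: flow_0 norm_vfst_vsnd)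
  have "((\<lambda>l. (norm (\<gamma> l T *v u - \<gamma> l0 T *v u))\<^sup>2) \<longlongrightarrow> 0) (at l0)"
  proof (rule tendsto_sandwich)
    show "\<forall>\<^sub>F l in at l0. 0 \<le> (norm (\<gamma> l T *v u - \<gamma> l0 T *v u))\<^sup>2" by simp
    show "\<forall>\<^sub>F l in at l0. (norm (\<gamma> l T *v u - \<gamma> l0 T *v u))\<^sup>2 \<le> ?C * (l - l0)\<^sup>2"
      unfolding eventually_at by (rule exI[of _ 1]) (use est in \<open>auto simp: dist_real_def\<close>)
    show "((\<lambda>l. ?C * (l - l0)\<^sup>2) \<longlongrightarrow> 0) (at l0)"
      by (rule tendsto_eq_intros refl | simp)+
  qed simp
  then have "((\<lambda>l. norm (\<gamma> l T *v u - \<gamma> l0 T *v u)) \<longlongrightarrow> 0) (at l0)"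
    using tendsto_real_sqrt[of _ 0] by fastforce
  then show ?thesis using Lim_null tendsto_norm_zero_iff by blast
qed

end

section \<open>The unitary matrix of a Lagrangian subspace\<close>

text \<open>The estimates above concern real solutions, whereas the Lagrangian subspaces are
  complex. A real matrix acts on the two parts separately, which transfers the estimates.\<close>

definition vRe :: "complex^'m \<Rightarrow> real^'m" where "vRe u = (\<chi> i. Re (u $ i))"
definition vIm :: "complex^'m \<Rightarrow> real^'m" where "vIm u = (\<chi> i. Im (u $ i))"

lemma vRe_vIm_mult [simp]:
  "vRe (map_matrix complex_of_real M *v u) = M *v vRe u"
  "vIm (map_matrix complex_of_real M *v u) = M *v vIm u"
  by (simp_all add: vRe_def vIm_def matrix_vector_mult_def vec_eq_iff map_matrix_def)

lemma vRe_vIm_vfst_vsnd [simp]: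
  "vRe (vfst u) = vfst (vRe u)" "vRe (vsnd u) = vsnd (vRe u)"
  "vIm (vfst u) = vfst (vIm u)" "vIm (vsnd u) = vsnd (vIm u)"
  by (simp_all add: vRe_def vIm_def vfst_def vsnd_def)

lemma vRe_vIm_uminus [simp]: "vRe (- u) = - vRe u" "vIm (- u) = - vIm u"
  by (simp_all add: vRe_def vIm_def vec_eq_iff)

lemma vRe_vIm_eq_0: "vRe u = 0 \<and> vIm u = 0 \<longleftrightarrow> u = 0"
  by (auto simp: vRe_def vIm_def vec_eq_iff complex_eq_iff)

lemma inner_vRe_vIm: "u \<bullet> v = vRe u \<bullet> vRe v + vIm u \<bullet> vIm v"
  by (simp add: vRe_def vIm_def inner_vec_def inner_complex_def sum.distrib)

lemma norm_vRe_vIm: "(norm u)\<^sup>2 = (norm (vRe u))\<^sup>2 + (norm (vIm u))\<^sup>2"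
  by (simp add: power2_norm_eq_inner inner_vRe_vIm)

lemma herm_inner_vRe_vIm:
  "herm_inner u v = Complex (vRe u \<bullet> vRe v + vIm u \<bullet> vIm v) (vIm u \<bullet> vRe v - vRe u \<bullet> vIm v)"
  by (simp add: herm_inner_def complex_eq_iff vRe_def vIm_def inner_vec_def sum.distrib sum_subtractf algebra_simps)

text \<open>On complex vectors \<open>\<bullet>\<close> is the real inner product; a Hermitian
  product known to be real can thus be replaced by it.\<close>

lemma Re_herm_inner: "Re (herm_inner u v) = u \<bullet> v"
  by (simp add: herm_inner_vRe_vIm inner_vRe_vIm)

lemma inner_vjoin: "vjoin a b \<bullet> vjoin c d = a \<bullet> c + b \<bullet> (d :: ('a::real_inner)^_)"
  by (simp add: inner_vec_def sum_UNIV_plus)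

lemma herm_inner_commute: "herm_inner v u = cnj (herm_inner u v)"
  by (simp add: herm_inner_def mult.commute)

lemma vec_linearI:
  fixes f :: "complex^'m \<Rightarrow> complex^'k"
  assumes "\<And>u v. f (u + v) = f u + f v" "\<And>c u. f (c *s u) = c *s f u"
  shows "Vector_Spaces.linear (*s) (*s) f"
  by unfold_locales (simp_all add: assms)

section \<open>Graphs and \<open>Lambda_D\<close> as Lagrangian subspaces\<close>

lemma range_mem_Lag:
  fixes f :: "complex^('n::finite + 'n) \<Rightarrow> 'n bdry"
  assumes f: "Vector_Spaces.linear (*s) (*s) f" "inj f" and "\<And>u v. Omega (f u) (f v) = 0"
  shows "range f \<in> Lag"
proof -
  have "vec.subspace (range f)" using f(1) by (intro vec.linear_subspace_image) auto
  moreover have "vec.dim (range f) = 2 * CARD('n)"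
    using vec.dim_image_eq[OF f(1), of UNIV] f(2) by (simp add: vec.dim_UNIV card_cart_basis)
  ultimately show ?thesis using assms(3) by (auto simp: Lag_def)
qed

lemma omega_eq_Complex:
  "omega u v = Complex
     ((vfst (vRe u) \<bullet> vsnd (vRe v) - vsnd (vRe u) \<bullet> vfst (vRe v)) + (vfst (vIm u) \<bullet> vsnd (vIm v) - vsnd (vIm u) \<bullet> vfst (vIm v)))
     ((vfst (vIm u) \<bullet> vsnd (vRe v) - vsnd (vIm u) \<bullet> vfst (vRe v)) - (vfst (vRe u) \<bullet> vsnd (vIm v) - vsnd (vRe u) \<bullet> vfst (vIm v)))"
  using omega_eq[of "vfst u" "vsnd u" "vfst v" "vsnd v"] by (simp add: herm_inner_vRe_vIm complex_eq_iff)

lemma Gr_mem_Lag: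
  fixes M :: "real^('n::finite + 'n)^('n + 'n)"
  assumes "symplectic M" shows "Gr M \<in> Lag"
proof -
  let ?f = "\<lambda>u. vjoin u (map_matrix complex_of_real M *v u) :: 'n bdry"
  have "range ?f \<in> Lag"
  proof (rule range_mem_Lag)
    show "Vector_Spaces.linear (*s) (*s) ?f"
      by (intro vec_linearI; simp add: vec_eq_iff vjoin_def matrix_vector_right_distrib vector_scalar_commute split: sum.split)
    show "inj ?f" by (auto simp: inj_def vjoin_inj)
    show "Omega (?f u) (?f v) = 0" for u v
      using assms by (simp add: Omega_def omega_eq_Complex symplectic_def complex_eq_iff)
  qed
  moreover have "Gr M = range ?f" by (auto simp: Gr_def)
  ultimately show ?thesis by simp
qed

lemma Lambda_D_mem_Lag: "(Lambda_D :: 'n::finite bdry set) \<in> Lag"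
proof -
  let ?f = "\<lambda>u. vjoin (vjoin (vfst u) 0) (vjoin (vsnd u) 0) :: 'n bdry"
  have "range ?f \<in> Lag"
  proof (rule range_mem_Lag)
    show "Vector_Spaces.linear (*s) (*s) ?f"
      by (intro vec_linearI; simp add: vec_eq_iff vjoin_def vfst_def vsnd_def split: sum.split)
    show "inj ?f" by (auto simp: inj_def vjoin_inj) (metis vjoin_eta)
    show "Omega (?f u) (?f v) = 0" for u v by (simp add: Omega_def omega_eq herm_inner_def)
  qed
  moreover have "Lambda_D = range ?f"
  proof (intro set_eqI iffI)
    fix v :: "'n bdry" assume v: "v \<in> Lambda_D"
    have "v = vjoin (vjoin (vfst (vfst v)) (vsnd (vfst v))) (vjoin (vfst (vsnd v)) (vsnd (vsnd v)))" by simp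
    also have "\<dots> = ?f (vjoin (vfst (vfst v)) (vfst (vsnd v)))" using v by (simp add: Lambda_D_def del: vjoin_eta)
    finally show "v \<in> range ?f" by blast
  qed (auto simp: Lambda_D_def)
  ultimately show ?thesis by simp
qed

section \<open>Unitarity and eigenvalues of \<open>lag_U\<close>\<close>

lemma canon_mem_lag_U:
  "L \<in> Lag \<Longrightarrow> vjoin a b \<in> canon ` L \<longleftrightarrow> a + \<i> *s b = lag_U L *v (a - \<i> *s b)"
  by (simp only: lag_U_char vjoin_mem)

text \<open>The equations \<open>a - \<i> b = w\<close> and \<open>a + \<i> b = U w\<close> are
  solved for \<open>a\<close> and \<open>b\<close>. Hence the effect of \<open>lag_U L\<close> on an
  arbitrary vector can be read off a point of \<open>L\<close>, without a frame.\<close>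

lemma lag_U_coords:
  assumes "L \<in> Lag"
  obtains a b where "vjoin a b \<in> canon ` L" "a - \<i> *s b = w" "a + \<i> *s b = lag_U L *v w"
proof -
  define U where "U = lag_U L"
  define a where "a = (1/2) *s (U *v w + w)"
  define b where "b = (- \<i>/2) *s (U *v w - w)"
  have h: "(p + q) / 2 - \<i> * (- \<i> / 2 * (p - q)) = q" "(p + q) / 2 + \<i> * (- \<i> / 2 * (p - q)) = p" for p q :: complex
    by (simp_all add: field_simps)
  have 1: "a - \<i> *s b = w" "a + \<i> *s b = U *v w"
    using h by (simp_all add: a_def b_def vec_eq_iff)
  show thesis
    by (rule that[of a b]) (use 1 in \<open>simp_all add: canon_mem_lag_U[OF assms] U_def\<close>)
qed

text \<open>Isotropy of a vector with itself says
  \<open>\<langle>a, b\<rangle> = \<langle>b, a\<rangle>\<close>, and these two are complex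
  conjugates.\<close>

lemma lag_herm_real:
  assumes "L \<in> Lag" "vjoin a b \<in> canon ` L"
  shows "herm_inner a b = of_real (a \<bullet> b)"
proof -
  have "omega (vjoin a b) (vjoin a b) = 0"
    using assms by (auto simp: Lag_def Omega_canon)
  then have "herm_inner a b = cnj (herm_inner a b)" by (simp add: omega_eq herm_inner_commute[of b a])
  then show ?thesis by (simp add: complex_eq_iff Re_herm_inner)
qed

lemma lag_norm_plus_minus:
  assumes "L \<in> Lag" "vjoin a b \<in> canon ` L"
  shows "(norm (a + \<i> *s b))\<^sup>2 = (norm a)\<^sup>2 + (norm b)\<^sup>2" "(norm (a - \<i> *s b))\<^sup>2 = (norm a)\<^sup>2 + (norm b)\<^sup>2"
proof -
  have h: "herm_inner b a = herm_inner a b"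
    using lag_herm_real[OF assms] herm_inner_commute[of b a] by simp
  have "complex_of_real ((norm (a + \<i> *s b))\<^sup>2) = of_real ((norm a)\<^sup>2 + (norm b)\<^sup>2)"
    "complex_of_real ((norm (a - \<i> *s b))\<^sup>2) = of_real ((norm a)\<^sup>2 + (norm b)\<^sup>2)"
    unfolding herm_self[symmetric] of_real_add by (simp_all add: herm_add herm_diff h algebra_simps)
  then show "(norm (a + \<i> *s b))\<^sup>2 = (norm a)\<^sup>2 + (norm b)\<^sup>2" "(norm (a - \<i> *s b))\<^sup>2 = (norm a)\<^sup>2 + (norm b)\<^sup>2"
    by (simp_all only: of_real_eq_iff)
qed

lemma norm_lag_U_mult:
  assumes "L \<in> Lag" shows "norm (lag_U L *v w) = norm w"
proof -
  obtain a b where ab: "vjoin a b \<in> canon ` L" "a - \<i> *s b = w" "a + \<i> *s b = lag_U L *v w"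
    by (rule lag_U_coords[OF assms])
  have "(norm (lag_U L *v w))\<^sup>2 = (norm w)\<^sup>2"
    using lag_norm_plus_minus[OF assms ab(1)] ab by simp
  then show ?thesis by simp
qed

text \<open>With \<open>w = a - \<i> b\<close>, \<open>c |w|\<^sup>2 = \<langle>a + \<i> b, a - \<i>
  b\<rangle> = |a|\<^sup>2 - |b|\<^sup>2 + 2 \<i> \<langle>a, b\<rangle>\<close>, so the sign of
  \<open>Im c\<close> is that of \<open>a \<bullet> b\<close>.\<close>

lemma lag_U_eigenvalue:
  assumes L: "L \<in> Lag" and ev: "lag_U L *v w = c *s w" "w \<noteq> 0"
    and pos: "\<And>a b. vjoin a b \<in> canon ` L \<Longrightarrow> a \<noteq> 0 \<or> b \<noteq> 0 \<Longrightarrow> 0 < a \<bullet> b"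
  shows "norm c = 1" "Im c > 0"
proof -
  have n: "norm (c *s w) = norm c * norm w"
    by (simp add: norm_vec_def norm_mult L2_set_right_distrib)
  then show "norm c = 1" using norm_lag_U_mult[OF L, of w] ev by simp
  obtain a b where ab: "vjoin a b \<in> canon ` L" "a - \<i> *s b = w" "a + \<i> *s b = lag_U L *v w"
    by (rule lag_U_coords[OF L])
  have "a \<noteq> 0 \<or> b \<noteq> 0" using ab(2) ev(2) by auto
  then have "0 < a \<bullet> b" using pos ab(1) by blast
  moreover have h: "herm_inner a b = of_real (a \<bullet> b)" "herm_inner b a = of_real (a \<bullet> b)"
    using lag_herm_real[OF L ab(1)] herm_inner_commute[of b a] by simp_all
  moreover have "herm_inner (c *s w) w = herm_inner (a + \<i> *s b) (a - \<i> *s b)"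
    using ab ev by simp
  then have "c * of_real ((norm w)\<^sup>2) = of_real ((norm a)\<^sup>2 - (norm b)\<^sup>2) + 2 * \<i> * of_real (a \<bullet> b)"
    unfolding herm_add herm_diff herm_self h by (simp add: algebra_simps)
  then have "Im c * (norm w)\<^sup>2 = 2 * (a \<bullet> b)" by (simp add: complex_eq_iff)
  ultimately have "Im c * (norm w)\<^sup>2 > 0" by simp
  then show "Im c > 0" by (simp add: zero_less_mult_iff)
qed

lemma lag_U_Lambda_D: "lag_U (Lambda_D :: 'n::finite bdry set) = mat 1"
proof -
  have "lag_U (Lambda_D :: 'n bdry set) *v w = mat 1 *v w" for w
  proof -
    obtain a b where ab: "vjoin a b \<in> canon ` (Lambda_D :: 'n bdry set)" "a - \<i> *s b = w" "a + \<i> *s b = lag_U (Lambda_D :: 'n bdry set) *v w"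
      by (rule lag_U_coords[OF Lambda_D_mem_Lag])
    then obtain v :: "'n bdry" where v: "v \<in> Lambda_D" "canon v = vjoin a b" by auto
    then have "b = vjoin 0 0" by (simp add: canon_def vjoin_inj Lambda_D_def)
    moreover have "vjoin 0 0 = (0 :: complex^('n + 'n))" by (simp add: vec_eq_iff vjoin_def split: sum.split)
    ultimately show ?thesis using ab by simp
  qed
  then show ?thesis by (simp add: matrix_eq)
qed

lemma tendsto_matrix:
  fixes A :: "'b \<Rightarrow> complex^'m::finite^'k::finite"
  assumes "\<And>w. ((\<lambda>l. A l *v w) \<longlongrightarrow> B *v w) F"
  shows "(A \<longlongrightarrow> B) F"
proof (intro vec_tendstoI)
  fix i j
  have "(C *v axis j 1) $ i = C $ i $ j" for C :: "complex^'m^'k"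
    by (simp add: matrix_vector_mult_def axis_def if_distrib if_distribR cong: if_cong)
  then show "((\<lambda>l. A l $ i $ j) \<longlongrightarrow> B $ i $ j) F"
    using tendsto_vec_nth[OF assms[of "axis j 1"], of i] by simp
qed

section \<open>Continuous eigenvalue angles\<close>

lemma eigenvector_exists:
  fixes M :: "complex^'m^'m"
  assumes "det (mat c - M) = 0"
  obtains w where "w \<noteq> 0" "M *v w = c *s w"
proof -
  have "\<not> invertible (mat c - M)" using assms by (simp add: invertible_det_nz)
  then obtain w where "w \<noteq> 0" "(mat c - M) *v w = 0"
    unfolding invertible_left_inverse matrix_left_invertible_ker by blast
  then show thesis using that by (simp add: mat_mult_add mat_mult_vec)
qed

lemma eigenvalues_are_eigenvector:
  assumes "eigenvalues_are M z"
  obtains w where "w \<noteq> 0" "M *v w = z j *s w"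
proof -
  have "(\<Prod>i\<in>UNIV. (z j - z i)) = 0" by (rule prod_zero) auto
  then have "det (mat (z j) - M) = 0" using assms by (simp add: eigenvalues_are_def)
  then show thesis using that by (rule eigenvector_exists)
qed

text \<open>\<open>eigenvalues_are\<close> treats the determinant as a function, whereas
  factorization over the complex numbers needs a polynomial. In the Leibniz expansion the identity
  gives a monic term of full degree; any other permutation moves some \<open>k\<close>, whose factor
  is constant, and so has smaller degree.\<close>

lemma char_poly_exists:
  fixes M :: "complex^'m::finite^'m"
  shows "\<exists>p. degree p = CARD('m) \<and> lead_coeff p = 1 \<and> (\<forall>x. poly p x = det (mat x - M))"
proof -
  let ?N = "CARD('m)" and ?S = "{\<sigma>. \<sigma> permutes (UNIV :: 'm set)}"
  define f where "f \<sigma> i = [: - M $ i $ \<sigma> i, if i = \<sigma> i then 1 else 0 :]" for \<sigma> i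
  define F where "F \<sigma> = smult (of_int (sign \<sigma>)) (\<Prod>i\<in>UNIV. f \<sigma> i)" for \<sigma>
  have fin: "finite ?S" by (simp add: finite_permutations)
  have split: "sum F ?S = F id + sum F (?S - {id})"
    using fin by (intro sum.remove) (auto simp: permutes_id)
  have id: "F id = (\<Prod>i\<in>UNIV. [: - M $ i $ i, 1 :])" by (simp add: F_def f_def sign_id)
  have deg_id: "degree (F id) = ?N" unfolding id by (subst degree_prod_sum_eq) auto
  have lead_id: "lead_coeff (F id) = 1" unfolding id by (simp add: lead_coeff_prod)
  have less: "degree (F \<sigma>) < ?N" if "\<sigma> \<in> ?S - {id}" for \<sigma>
  proof -
    from that have "\<sigma> \<noteq> id" by simp
    then obtain k where k: "\<sigma> k \<noteq> k" by (metis eq_id_iff)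
    have "degree (F \<sigma>) \<le> degree (\<Prod>i\<in>UNIV. f \<sigma> i)" by (simp add: F_def degree_smult_le)
    also have "\<dots> \<le> (\<Sum>i\<in>UNIV. degree (f \<sigma> i))" by (rule order_trans[OF degree_prod_sum_le]) auto
    also have "\<dots> \<le> (\<Sum>i\<in>UNIV. if i = k then 0 else 1)"
      using k by (intro sum_mono) (auto simp: f_def)
    also have "\<dots> = card (UNIV - {k})" by (subst sum.remove[of _ k]) auto
    also have "\<dots> < ?N" by (rule psubset_card_mono) auto
    finally show ?thesis .
  qed
  have rest: "degree (sum F (?S - {id})) < ?N"
    using less by (intro degree_sum_less) auto
  show ?thesis
  proof (intro exI[of _ "sum F ?S"] conjI allI)
    show deg: "degree (sum F ?S) = ?N"
      unfolding split using rest deg_id by (subst degree_add_eq_left) auto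
    show "lead_coeff (sum F ?S) = 1"
      unfolding deg unfolding split using rest lead_id deg_id by (simp add: coeff_eq_0)
    fix x
    show "poly (sum F ?S) x = det (mat x - M)"
      unfolding det_def poly_sum
      by (intro sum.cong refl) (auto simp: F_def f_def poly_prod mat_def intro!: prod.cong)
  qed
qed

text \<open>The product determines its multiset of roots, \<open>Arg\<close> inverts
  \<open>cis\<close> on \<open>{0..pi}\<close>, and a sorted list is determined by its
  multiset.\<close>

lemma cis_roots_unique:
  assumes "\<And>x. (\<Prod>r\<leftarrow>xs. x - cis r) = (\<Prod>r\<leftarrow>ys. x - cis r)"
    and "set xs \<subseteq> {0..pi}" "set ys \<subseteq> {0..pi}" "sorted xs" "sorted ys"
  shows "xs = ys"
proof -
  have "poly (\<Prod>r\<leftarrow>zs. [: - cis r, 1 :]) x = (\<Prod>r\<leftarrow>zs. x - cis r)" for zs x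
    by (induction zs) (auto simp: algebra_simps)
  then have "poly (\<Prod>r\<leftarrow>xs. [: - cis r, 1 :]) = poly (\<Prod>r\<leftarrow>ys. [: - cis r, 1 :])"
    using assms(1) by presburger
  then have "(\<Prod>r\<leftarrow>xs. [: - cis r, 1 :]) = (\<Prod>r\<leftarrow>ys. [: - cis r, 1 :])"
    by (simp only: poly_eq_poly_eq_iff)
  moreover have "proots (\<Prod>r\<leftarrow>zs. [: - cis r, 1 :]) = mset (map cis zs)" for zs
  proof -
    have "0 \<notin> set (map (\<lambda>r. [: - cis r, 1 :]) zs)" by auto
    then have "proots (\<Prod>r\<leftarrow>zs. [: - cis r, 1 :]) = (\<Sum>p\<leftarrow>map (\<lambda>r. [: - cis r, 1 :]) zs. proots p)"
      by (metis (no_types) list.map_ident proots_prod_list)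
    also have "\<dots> = mset (map cis zs)" by (induction zs) auto
    finally show ?thesis .
  qed
  ultimately have "mset (map cis xs) = mset (map cis ys)" by metis
  then have "image_mset Arg (mset (map cis xs)) = image_mset Arg (mset (map cis ys))" by simp
  moreover have "map (Arg \<circ> cis) zs = zs" if "set zs \<subseteq> {0..pi}" for zs
  proof (rule map_idI)
    fix x assume "x \<in> set zs"
    then have "0 \<le> x" "x \<le> pi" using that by auto
    then have "- pi < x" "x \<le> pi" using pi_gt_zero by linarith+
    then show "(Arg \<circ> cis) x = x" by (simp add: Arg_cis)
  qed
  ultimately have "mset xs = mset ys" using assms(2,3) by (simp flip: mset_map add: comp_def)
  then show ?thesis using assms(4,5) by (metis properties_for_sort)
qed

text \<open>The angles are the principal arguments of the roots of the characteristic polynomial;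
  norm 1 gives \<open>cis (Arg c) = c\<close>, and \<open>Im c \<ge> 0\<close> puts them into
  \<open>{0..pi}\<close>.\<close>

lemma eigen_angle_list:
  fixes M :: "complex^'m::finite^'m"
  assumes "\<And>c w. w \<noteq> 0 \<Longrightarrow> M *v w = c *s w \<Longrightarrow> norm c = 1 \<and> Im c \<ge> 0"
  obtains xs where "length xs = CARD('m)" "sorted xs" "set xs \<subseteq> {0..pi}"
    "\<And>x. det (mat x - M) = (\<Prod>r\<leftarrow>xs. x - cis r)"
proof -
  obtain p where p: "degree p = CARD('m)" "lead_coeff p = 1" "\<And>x. poly p x = det (mat x - M)"
    using char_poly_exists[of M] by blast
  then have "p \<noteq> 0" by fastforce
  then obtain A where A: "size A = degree p" "p = smult (lead_coeff p) (\<Prod>x\<in>#A. [:-x, 1:])"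
    using alg_closed_imp_factorization[OF \<open>p \<noteq> 0\<close>] by blast
  have p_eq: "p = (\<Prod>x\<in>#A. [:-x, 1:])" using A(2) unfolding p(2) smult_1_left .
  have poly_p: "poly p x = (\<Prod>c\<in>#A. x - c)" for x
  proof -
    have "poly (\<Prod>x\<in>#B. [:-x, 1:]) x = (\<Prod>c\<in>#B. x - c)" for B
      by (induction B) (auto simp: algebra_simps)
    then show ?thesis by (simp add: p_eq)
  qed
  have root: "norm c = 1 \<and> Im c \<ge> 0" if "c \<in># A" for c
  proof -
    have "poly p c = 0" unfolding poly_p using that by (auto simp: prod_mset_zero_iff)
    then have "det (mat c - M) = 0" using p(3) by simp
    then obtain w where "w \<noteq> 0" "M *v w = c *s w" by (rule eigenvector_exists)
    then show ?thesis by (rule assms)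
  qed
  obtain xs where mxs: "mset xs = image_mset Arg A" and sorted_xs: "sorted xs"
    using mset_sorted_list_of_multiset[of "image_mset Arg A"] sorted_sorted_list_of_multiset[of "image_mset Arg A"]
    by blast
  have "image_mset (\<lambda>c. cis (Arg c)) A = A"
  proof -
    have "cis (Arg c) = c" if "c \<in># A" for c
      using root[OF that] by (subst cis_Arg) (auto simp: sgn_eq)
    then have "image_mset (\<lambda>c. cis (Arg c)) A = image_mset (\<lambda>c. c) A" by (rule image_mset_cong)
    then show ?thesis by simp
  qed
  then have A_eq: "mset (map cis xs) = A"
    unfolding mset_map mxs image_mset.compositionality comp_def .
  show thesis
  proof (rule that[of xs])
    show "length xs = CARD('m)" using A(1) p(1) size_mset[of xs] by (simp only: mxs size_image_mset)
    show "sorted xs" by (rule sorted_xs)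
    have set_xs: "set xs = Arg ` set_mset A" unfolding set_mset_mset[symmetric] mxs set_image_mset ..
    have "Arg c \<in> {0..pi}" if "c \<in># A" for c
      using root[OF that] Arg_le_pi[of c] Arg_less_0[of c] by simp
    then show "set xs \<subseteq> {0..pi}" unfolding set_xs by (rule image_subsetI)
    show "det (mat x - M) = (\<Prod>r\<leftarrow>xs. x - cis r)" for x
    proof -
      have "det (mat x - M) = (\<Prod>c\<in>#A. x - c)" using p(3)[of x] poly_p[of x] by (rule subst)
      also have "\<dots> = prod_mset (mset (map (\<lambda>r. x - cis r) xs))"
        unfolding A_eq[symmetric] mset_map image_mset.compositionality comp_def ..
      finally show ?thesis by (simp only: prod_mset_prod_list)
    qed
  qed
qed

lemma continuous_on_det:
  fixes A :: "'b::topological_space \<Rightarrow> complex^'m::finite^'m"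
  assumes "continuous_on S A"
  shows "continuous_on S (\<lambda>z. det (A z))"
proof -
  have "continuous_on S (\<lambda>z. A z $ i $ j)" for i j
    using assms unfolding continuous_on_def by (intro ballI tendsto_vec_nth) auto
  then show ?thesis
    unfolding det_def by (intro continuous_on_sum continuous_on_mult continuous_on_const continuous_on_prod)
qed

text \<open>In the closed upper half circle the sorted angle vector is unique, takes values in a
  compact box and has a closed graph over \<open>{a..b}\<close>; a map with closed graph into a
  compact set is continuous.\<close>

lemma eigen_angles_exist:
  fixes U :: "real \<Rightarrow> complex^'m::finite^'m"
  assumes cont: "continuous_on {a..b} U"
    and ev: "\<And>t c w. t \<in> {a..b} \<Longrightarrow> w \<noteq> 0 \<Longrightarrow> U t *v w = c *s w \<Longrightarrow> norm c = 1 \<and> Im c \<ge> 0"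
  obtains \<theta> where "\<And>j. continuous_on {a..b} (\<theta> j)"
    "\<And>t. t \<in> {a..b} \<Longrightarrow> eigenvalues_are (U t) (\<lambda>j. cis (\<theta> j t))"
proof -
  let ?N = "CARD('m)"
  \<comment> \<open>The index type carries no order; the enumeration \<open>e\<close> supplies the
    one along which angles are sorted.\<close>
  obtain e :: "'m \<Rightarrow> nat" where e: "bij_betw e UNIV {0..<?N}"
    using ex_bij_betw_finite_nat[of "UNIV :: 'm set"] by auto
  define g where "g = inv_into UNIV e"
  have g: "bij_betw g {0..<?N} UNIV" unfolding g_def by (rule bij_betw_inv_into[OF e])
  have eg: "e (g i) = i" if "i < ?N" for i
    using that e unfolding g_def by (intro f_inv_into_f) (auto simp: bij_betw_def)
  have ge: "g (e j) = j" for j using e unfolding g_def by (intro inv_into_f_f) (auto simp: bij_betw_def)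
  have e_lt: "e j < ?N" for j using e by (auto simp: bij_betw_def)
  \<comment> \<open>Range and sortedness make \<open>v\<close> unique, and all three conditions are
    closed, as the closed graph argument requires.\<close>
  define good where "good t v \<longleftrightarrow> (\<forall>j. v $ j \<in> {0..pi}) \<and> (\<forall>i j. e i \<le> e j \<longrightarrow> v $ i \<le> v $ j) \<and>
    (\<forall>x. det (mat x - U t) = (\<Prod>j\<in>UNIV. x - cis (v $ j)))" for t and v :: "real^'m"
  define lst where "lst v = map (\<lambda>i. v $ g i) [0..<?N]" for v :: "real^'m"
  have prod: "(\<Prod>j\<in>UNIV. x - cis (v $ j)) = (\<Prod>r\<leftarrow>lst v. x - cis r)" for x v
  proof -
    have "(\<Prod>j\<in>UNIV. x - cis (v $ j)) = (\<Prod>i\<in>{0..<?N}. x - cis (v $ g i))"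
      by (rule prod.reindex_bij_betw[OF g, symmetric])
    then show ?thesis by (simp add: lst_def comp_def prod.distinct_set_conv_list[symmetric])
  qed
  have ex: "\<exists>v. good t v" if t: "t \<in> {a..b}" for t
  proof -
    obtain xs where xs: "length xs = ?N" "sorted xs" "set xs \<subseteq> {0..pi}"
      "\<And>x. det (mat x - U t) = (\<Prod>r\<leftarrow>xs. x - cis r)"
      using eigen_angle_list[of "U t"] ev[OF t] by metis
    let ?v = "(\<chi> j. xs ! e j) :: real^'m"
    have "lst ?v = xs" unfolding lst_def by (rule nth_equalityI) (auto simp: xs eg)
    moreover have "xs ! e j \<in> {0..pi}" for j using xs(1,3) e_lt[of j] nth_mem by (metis subsetD)
    moreover have "xs ! e i \<le> xs ! e j" if "e i \<le> e j" for i j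
      using that xs(1,2) e_lt by (intro sorted_nth_mono) auto
    ultimately have "good t ?v" unfolding good_def prod using xs(4) by simp
    then show ?thesis ..
  qed
  have unique: "v = v'" if "good t v" "good t v'" for t v v'
  proof -
    have det: "(\<Prod>r\<leftarrow>lst w. x - cis r) = det (mat x - U t)" if "good t w" for w x
      using that by (simp add: good_def prod)
    have "lst v = lst v'"
    proof (rule cis_roots_unique)
      show "(\<Prod>r\<leftarrow>lst v. x - cis r) = (\<Prod>r\<leftarrow>lst v'. x - cis r)" for x
        using that det by simp
      have "sorted (lst w)" if "good t w" for w
        using that unfolding good_def lst_def by (auto simp: sorted_iff_nth_mono eg)
      then show "sorted (lst v)" "sorted (lst v')" using that by auto
    qed (use that in \<open>auto simp: good_def lst_def\<close>)
    then have "v $ g i = v' $ g i" if "i < ?N" for i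
      using that unfolding lst_def by (auto dest: map_eq_conv[THEN iffD1])
    then have "v $ j = v' $ j" for j using e_lt ge by metis
    then show ?thesis by (simp add: vec_eq_iff)
  qed
  define f where "f t = (SOME v. good t v)" for t
  have f: "good t (f t)" if "t \<in> {a..b}" for t unfolding f_def using ex[OF that] by (rule someI_ex)
  let ?B = "cbox 0 (\<chi> j. pi) :: (real^'m) set"
  have B: "v \<in> ?B \<longleftrightarrow> (\<forall>j. v $ j \<in> {0..pi})" for v by (simp add: mem_box_cart)
  have "continuous_on {a..b} f"
  proof (rule continuous_from_closed_graph)
    show "compact ?B" by simp
    show "f \<in> {a..b} \<rightarrow> ?B" using f by (auto simp: good_def B)
    \<comment> \<open>Each single \<open>x\<close> gives a closed condition on
      \<open>(t, v)\<close>; the graph of \<open>f\<close> is the intersection of all of them with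
      the sorted vectors.\<close>
    define D where "D x = {z \<in> {a..b} \<times> ?B. det (mat x - U (fst z)) - (\<Prod>j\<in>UNIV. x - cis (snd z $ j)) = 0}" for x
    define S where "S = {z :: real \<times> (real^'m). \<forall>i j. e i \<le> e j \<longrightarrow> snd z $ i \<le> snd z $ j}"
    have "closed (D x)" for x
      unfolding D_def
    proof (rule continuous_closed_preimage_constant)
      have "continuous_on ({a..b} \<times> ?B) (\<lambda>z. U (fst z))"
        by (rule continuous_on_compose2[OF cont continuous_on_fst[OF continuous_on_id]]) auto
      then have "continuous_on ({a..b} \<times> ?B) (\<lambda>z. det (mat x - U (fst z)))"
        by (intro continuous_on_det continuous_on_diff continuous_on_const)
      moreover have "continuous_on ({a..b} \<times> ?B) (\<lambda>z. \<Prod>j\<in>UNIV. x - cis (snd z $ j))"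
        by (intro continuous_intros)
      ultimately show "continuous_on ({a..b} \<times> ?B) (\<lambda>z. det (mat x - U (fst z)) - (\<Prod>j\<in>UNIV. x - cis (snd z $ j)))"
        by (rule continuous_on_diff)
    qed (intro closed_Times closed_cbox closed_atLeastAtMost)
    moreover have "closed S"
      unfolding S_def
      by (intro closed_Collect_all closed_Collect_imp open_Collect_const closed_Collect_le continuous_intros)
    ultimately have "closed ((\<Inter>x. D x) \<inter> S)" by blast
    moreover have mem: "(t, v) \<in> (\<Inter>x. D x) \<inter> S \<longleftrightarrow> t \<in> {a..b} \<and> good t v" for t v
      unfolding good_def by (simp add: D_def S_def B) blast
    have "(\<lambda>t. (t, f t)) ` {a..b} = (\<Inter>x. D x) \<inter> S"
    proof (intro set_eqI iffI)
      fix z assume "z \<in> (\<lambda>t. (t, f t)) ` {a..b}"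
      then obtain t where "t \<in> {a..b}" "z = (t, f t)" by blast
      then show "z \<in> (\<Inter>x. D x) \<inter> S" using mem f by metis
    next
      fix z assume z: "z \<in> (\<Inter>x. D x) \<inter> S"
      obtain t v where tv: "z = (t, v)" by force
      have "t \<in> {a..b}" "good t v" using z unfolding tv mem by auto
      moreover from this have "v = f t" using unique f by metis
      ultimately show "z \<in> (\<lambda>t. (t, f t)) ` {a..b}" unfolding tv by blast
    qed
    ultimately show "closed ((\<lambda>t. (t, f t)) ` {a..b})" by metis
  qed
  then show thesis
    using f by (intro that[of "\<lambda>j t. f t $ j"]) (auto intro!: continuous_intros simp: good_def eigenvalues_are_def)
qed

text \<open>At \<open>a\<close> the angle is an exact multiple of \<open>2 * pi\<close>, so its
  ceiling is that multiple. Afterwards the sine is positive, so the shifted angle cannot reach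
  \<open>pi\<close> or \<open>- pi\<close> by the intermediate value theorem, and ends in the open
  interval from 0 to \<open>pi\<close>, where the ceiling is one higher.\<close>

lemma ceiling_angle_jump:
  fixes a b :: real and \<theta> :: "real \<Rightarrow> real"
  assumes "a < b" and cont: "continuous_on {a..b} \<theta>" and a: "cis (\<theta> a) = 1"
    and pos: "\<And>t. t \<in> {a<..b} \<Longrightarrow> Im (cis (\<theta> t)) > 0"
  shows "\<lceil>\<theta> b / (2 * pi)\<rceil> - \<lceil>\<theta> a / (2 * pi)\<rceil> = 1"
proof -
  have "cos (\<theta> a) = 1" using a by (simp add: complex_eq_iff)
  then obtain m :: int where m: "\<theta> a = of_int m * 2 * pi" using cos_one_2pi_int by auto
  define \<phi> where "\<phi> t = \<theta> t - of_int m * 2 * pi" for t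
  have sin: "sin (\<phi> t) > 0" if "t \<in> {a<..b}" for t
  proof -
    have "sin (\<phi> t) = sin (\<theta> t)"
      using sin.plus_of_int[of "\<phi> t" m] by (simp add: \<phi>_def mult_ac)
    then show ?thesis using pos[OF that] by simp
  qed
  have \<phi>a: "\<phi> a = 0" by (simp add: \<phi>_def m)
  have c: "continuous_on {a..b} \<phi>" unfolding \<phi>_def by (intro continuous_intros cont)
  have no: "\<phi> t \<noteq> y" if "t \<in> {a..b}" "y \<noteq> 0" "sin y = 0" for t y
  proof (cases "t = a")
    case False
    then have "t \<in> {a<..b}" using that(1) by auto
    then show ?thesis using sin[of t] that(3) by auto
  qed (use that \<phi>a in auto)
  have "\<phi> b < pi"
  proof (rule ccontr)
    assume "\<not> \<phi> b < pi"
    then obtain t where "t \<in> {a..b}" "\<phi> t = pi"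
      using IVT'[of \<phi> a pi b] c \<phi>a assms(1) by force
    then show False using no[of t pi] by simp
  qed
  moreover have "- pi < \<phi> b"
  proof (rule ccontr)
    assume "\<not> - pi < \<phi> b"
    then obtain t where "t \<in> {a..b}" "\<phi> t = - pi"
      using IVT2'[of \<phi> b "- pi" a] c \<phi>a assms(1) by force
    then show False using no[of t "- pi"] by simp
  qed
  moreover have "\<not> \<phi> b \<le> 0"
  proof
    assume "\<phi> b \<le> 0"
    then have "sin (- \<phi> b) \<ge> 0" using \<open>- pi < \<phi> b\<close> by (intro sin_ge_zero) auto
    then show False using sin[of b] assms(1) by simp
  qed
  ultimately have "\<lceil>\<phi> b / (2 * pi)\<rceil> = 1" by (intro ceiling_unique) (auto simp: field_simps)
  moreover have "\<theta> b / (2 * pi) = \<phi> b / (2 * pi) + of_int m" by (simp add: \<phi>_def field_simps)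
  ultimately show ?thesis by (simp add: m)
qed

section \<open>Graphs of symplectic matrices and the Maslov index\<close>

lemma limitin_lag_topology:
  fixes f :: "'b \<Rightarrow> 'n::finite bdry set"
  assumes "\<And>x. f x \<in> Lag" "L \<in> Lag" "((\<lambda>x. lag_U (f x)) \<longlongrightarrow> lag_U L) F"
  shows "limitin lag_topology f L F"
  unfolding lag_topology_def Metric_space.limitin_metric[OF Metric_space_Lag]
proof (intro conjI allI impI)
  fix \<epsilon> :: real assume "\<epsilon> > 0"
  from tendstoD[OF assms(3) this] show "\<forall>\<^sub>F x in F. f x \<in> Lag \<and> lag_dist (f x) L < \<epsilon>"
    by eventually_elim (simp add: assms(1) lag_dist_def dist_norm)
qed (rule assms(2))

lemma continuous_map_lag_topology:
  fixes f :: "'b::topological_space \<Rightarrow> 'n::finite bdry set"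
  assumes "\<And>x. x \<in> S \<Longrightarrow> f x \<in> Lag" "continuous_on S (\<lambda>x. lag_U (f x))"
  shows "continuous_map (top_of_set S) lag_topology f"
  unfolding lag_topology_def Metric_space.continuous_map_to_metric[OF Metric_space_Lag]
proof (intro ballI allI impI)
  fix x and \<epsilon> :: real assume x: "x \<in> topspace (top_of_set S)" and \<epsilon>: "\<epsilon> > 0"
  let ?U = "S \<inter> (\<lambda>x. lag_U (f x)) -` ball (lag_U (f x)) \<epsilon>"
  have "openin (top_of_set S) ?U"
    by (rule continuous_openin_preimage_gen[OF assms(2)]) simp
  moreover have "x \<in> ?U" using x \<epsilon> by simp
  moreover have "f y \<in> Metric_space.mball Lag lag_dist (f x) \<epsilon>" if "y \<in> ?U" for y
    using that x assms(1) by (simp add: Metric_space.in_mball[OF Metric_space_Lag] lag_dist_def dist_norm)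
  ultimately show "\<exists>U. openin (top_of_set S) U \<and> x \<in> U \<and> (\<forall>y\<in>U. f y \<in> Metric_space.mball Lag lag_dist (f x) \<epsilon>)"
    by blast
qed

text \<open>The path leaves \<open>\<Lambda>\<^sub>D\<close> with every eigenvalue of \<open>\<U>\<close> entering the open upper half circle.\<close>

lemma maslov_Lambda_D:
  fixes L :: "real \<Rightarrow> 'n::finite bdry set"
  assumes ab: "a < b" and La: "L a = Lambda_D" and Lag: "\<And>t. t \<in> {a..b} \<Longrightarrow> L t \<in> Lag"
    and cont: "continuous_on {a..b} (\<lambda>t. lag_U (L t))"
    and pos: "\<And>t u v. t \<in> {a<..b} \<Longrightarrow> vjoin u v \<in> canon ` L t \<Longrightarrow> u \<noteq> 0 \<or> v \<noteq> 0 \<Longrightarrow> 0 < u \<bullet> v"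
  shows "maslov Lambda_D L a b = 2 * int CARD('n)"
proof -
  have "matrix_inv (mat 1 :: complex^('n + 'n)^('n + 'n)) = mat 1"
    using matrix_inv_right[of "mat 1 :: complex^('n + 'n)^('n + 'n)"] by (auto simp: invertible_def)
  then have angles: "eigen_angles Lambda_D L a b \<theta> \<longleftrightarrow> (\<forall>j. continuous_on {a..b} (\<theta> j)) \<and>
     (\<forall>t\<in>{a..b}. eigenvalues_are (lag_U (L t)) (\<lambda>j. cis (\<theta> j t)))" for \<theta>
    by (simp add: eigen_angles_def lag_U_Lambda_D)
  have at_a: "c = 1" if "lag_U (L a) *v w = c *s w" "w \<noteq> 0" for c w
  proof -
    obtain i where "w $ i \<noteq> 0" using \<open>w \<noteq> 0\<close> by (auto simp: vec_eq_iff)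
    moreover have "w $ i = c * w $ i"
      using arg_cong[OF that(1), of "\<lambda>v. v $ i"] by (simp add: La lag_U_Lambda_D)
    ultimately show ?thesis by simp
  qed
  have after_a: "norm c = 1 \<and> Im c > 0" if "t \<in> {a<..b}" "lag_U (L t) *v w = c *s w" "w \<noteq> 0" for t c w
    using lag_U_eigenvalue[OF Lag that(2,3)] pos[OF that(1)] that(1) by auto
  \<comment> \<open>At \<open>t = a\<close> all eigenvalues equal 1, the boundary case that the
    non-strict inequality admits.\<close>
  have "norm c = 1 \<and> Im c \<ge> 0" if "t \<in> {a..b}" "w \<noteq> 0" "lag_U (L t) *v w = c *s w" for t c w
  proof (cases "t = a")
    case True
    then show ?thesis using at_a that by force
  next
    case False
    then show ?thesis using after_a[of t w c] that by force
  qed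
  then obtain \<theta> where \<theta>: "eigen_angles Lambda_D L a b \<theta>"
    using eigen_angles_exist[OF cont] unfolding angles by metis
  \<comment> \<open>Proved for an arbitrary choice of angles: this is the uniqueness that the
    definite description in \<open>maslov\<close> demands.\<close>
  have index: "(\<Sum>j\<in>UNIV. (\<lceil>\<theta> j b / (2 * pi)\<rceil> - \<lceil>\<theta> j a / (2 * pi)\<rceil>)) = 2 * int CARD('n)"
    if "eigen_angles Lambda_D L a b \<theta>" for \<theta>
  proof -
    have ev: "\<exists>w. w \<noteq> 0 \<and> lag_U (L t) *v w = cis (\<theta> j t) *s w" if "t \<in> {a..b}" for t j
      using \<open>eigen_angles Lambda_D L a b \<theta>\<close> that unfolding angles by (meson eigenvalues_are_eigenvector)
    have "\<lceil>\<theta> j b / (2 * pi)\<rceil> - \<lceil>\<theta> j a / (2 * pi)\<rceil> = 1" for j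
    proof (rule ceiling_angle_jump[OF ab])
      show "continuous_on {a..b} (\<theta> j)" using that unfolding angles by blast
      show "cis (\<theta> j a) = 1" using ev[of a j] ab at_a by auto
      show "Im (cis (\<theta> j t)) > 0" if "t \<in> {a<..b}" for t
        using ev[of t j] that after_a[OF that] by force
    qed
    then show ?thesis by simp
  qed
  show ?thesis
    unfolding maslov_def
  proof (rule the_equality)
    show "\<exists>\<theta>. eigen_angles Lambda_D L a b \<theta> \<and>
        2 * int CARD('n) = (\<Sum>j\<in>UNIV. (\<lceil>\<theta> j b / (2 * pi)\<rceil> - \<lceil>\<theta> j a / (2 * pi)\<rceil>))"
      using \<theta> index[OF \<theta>] by auto
  qed (use index in auto)
qed

section \<open>Graphs: positivity, closeness to \<open>Lambda_D\<close>, continuous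
  dependence\<close>

lemma Gr_coords:
  fixes M :: "real^('n::finite + 'n)^('n + 'n)"
  assumes "vjoin a b \<in> canon ` Gr M"
  obtains u where "a = vjoin (- vfst u) (vfst (map_matrix complex_of_real M *v u))"
    "b = vjoin (vsnd u) (vsnd (map_matrix complex_of_real M *v u))"
proof -
  obtain u where "vjoin a b = canon (vjoin u (map_matrix complex_of_real M *v u))"
    using assms unfolding Gr_def by blast
  then have "a = vjoin (- vfst u) (vfst (map_matrix complex_of_real M *v u))"
    "b = vjoin (vsnd u) (vsnd (map_matrix complex_of_real M *v u))"
    by (simp_all add: canon_def vjoin_inj)
  then show thesis by (rule that)
qed

lemma Gr_inner:
  fixes u :: "complex^('n::finite + 'n)"
  shows "vjoin (- vfst u) (vfst (map_matrix complex_of_real M *v u))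
      \<bullet> vjoin (vsnd u) (vsnd (map_matrix complex_of_real M *v u))
    = boundary_form M (vRe u) + boundary_form M (vIm u)"
  unfolding inner_vjoin unfolding boundary_form_def inner_vRe_vIm vRe_vIm_uminus
    vRe_vIm_vfst_vsnd vRe_vIm_mult inner_minus_left
  by (simp only: algebra_simps)

lemma Gr_inner_pos:
  assumes "\<And>u. u \<noteq> 0 \<Longrightarrow> 0 < boundary_form M u" "vjoin a b \<in> canon ` Gr M" "a \<noteq> 0 \<or> b \<noteq> 0"
  shows "0 < a \<bullet> b"
proof -
  obtain u where u: "a = vjoin (- vfst u) (vfst (map_matrix complex_of_real M *v u))"
    "b = vjoin (vsnd u) (vsnd (map_matrix complex_of_real M *v u))"
    using assms(2) by (rule Gr_coords)
  have z: "vfst 0 = 0" "vsnd 0 = 0" "vjoin 0 0 = 0"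
    by (simp_all add: vfst_def vsnd_def vjoin_def vec_eq_iff split: sum.split)
  have "u \<noteq> 0" using assms(3) u by (auto simp: z)
  then have "vRe u \<noteq> 0 \<or> vIm u \<noteq> 0" using vRe_vIm_eq_0 by blast
  moreover have "boundary_form M w \<ge> 0" for w
    using assms(1)[of w] by (cases "w = 0") (auto simp: boundary_form_def z)
  ultimately show ?thesis unfolding u Gr_inner using assms(1) by (metis add_nonneg_pos add_pos_nonneg)
qed

text \<open>Cauchy-Schwarz in \<open>|b|\<^sup>2 \<le> \<delta> \<langle>a, b\<rangle>\<close> and
  division by \<open>|b|\<close> give \<open>|b| \<le> \<delta> |a|\<close>. Moreover
  \<open>|w|\<^sup>2 = |a|\<^sup>2 + |b|\<^sup>2\<close>, so \<open>|a| \<le> |w|\<close>, and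
  \<open>U w - w = 2 \<i> b\<close>.\<close>

lemma lag_U_Gr_near_1:
  fixes M :: "real^('n::finite + 'n)^('n + 'n)"
  assumes M: "symplectic M" and \<delta>: "\<delta> > 0"
    and est: "\<And>u. (norm (vsnd u))\<^sup>2 + (norm (vsnd (M *v u)))\<^sup>2 \<le> \<delta> * boundary_form M u"
  shows "norm (lag_U (Gr M) *v w - w) \<le> 2 * \<delta> * norm w"
proof -
  obtain a b where ab: "vjoin a b \<in> canon ` Gr M" "a - \<i> *s b = w" "a + \<i> *s b = lag_U (Gr M) *v w"
    by (rule lag_U_coords[OF Gr_mem_Lag[OF M]])
  obtain u where u: "a = vjoin (- vfst u) (vfst (map_matrix complex_of_real M *v u))"
    "b = vjoin (vsnd u) (vsnd (map_matrix complex_of_real M *v u))"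
    using ab(1) by (rule Gr_coords)
  have "(norm b)\<^sup>2 \<le> \<delta> * (a \<bullet> b)"
    using est[of "vRe u"] est[of "vIm u"] unfolding u Gr_inner norm_vjoin
    by (simp add: norm_vRe_vIm algebra_simps)
  also have "\<dots> \<le> \<delta> * (norm a * norm b)" using \<delta> by (intro mult_left_mono norm_cauchy_schwarz) auto
  finally have "norm b * norm b \<le> norm b * (\<delta> * norm a)" by (simp add: power2_eq_square mult_ac)
  then have b: "norm b \<le> \<delta> * norm a" using \<delta> by (cases "b = 0") auto
  have "(norm w)\<^sup>2 = (norm a)\<^sup>2 + (norm b)\<^sup>2"
    using lag_norm_plus_minus(2)[OF Gr_mem_Lag[OF M] ab(1)] ab(2) by simp
  then have "(norm a)\<^sup>2 \<le> (norm w)\<^sup>2" by simp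
  then have a: "norm a \<le> norm w" by (rule power2_le_imp_le) (rule norm_ge_zero)
  have "lag_U (Gr M) *v w - w = (2 * \<i>) *s b"
  proof -
    have "lag_U (Gr M) *v w - w = (a + \<i> *s b) - (a - \<i> *s b)" by (simp only: ab)
    then show ?thesis by (simp add: vec_eq_iff)
  qed
  moreover have "norm (c *s b) = norm c * norm b" for c
    by (simp add: norm_vec_def norm_mult L2_set_right_distrib)
  ultimately have "norm (lag_U (Gr M) *v w - w) = 2 * norm b" by (simp add: norm_mult)
  also have "\<dots> \<le> 2 * (\<delta> * norm w)"
    using b mult_left_mono[OF a, of \<delta>] \<delta> by linarith
  finally show ?thesis by simp
qed

lemma tendsto_lag_U_mat_1:
  fixes M :: "'b \<Rightarrow> real^('n::finite + 'n)^('n + 'n)"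
  assumes M: "\<And>l. symplectic (M l)"
    and est: "\<And>\<delta>. \<delta> > 0 \<Longrightarrow> \<forall>\<^sub>F l in F. \<forall>u. (norm (vsnd u))\<^sup>2 + (norm (vsnd (M l *v u)))\<^sup>2 \<le> \<delta> * boundary_form (M l) u"
  shows "((\<lambda>l. lag_U (Gr (M l))) \<longlongrightarrow> mat 1) F"
proof (rule tendsto_matrix, rule tendstoI)
  fix w :: "complex^('n + 'n)" and e :: real assume e: "e > 0"
  \<comment> \<open>Chosen so that \<open>2 * \<delta> * norm w < e\<close>; the \<open>+ 1\<close>
    covers \<open>w = 0\<close>.\<close>
  define \<delta> where "\<delta> = e / 2 / (norm w + 1)"
  have n: "norm w + 1 > 0" by (simp add: add_nonneg_pos)
  have \<delta>: "\<delta> > 0" unfolding \<delta>_def using e n by simp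
  have "2 * \<delta> * norm w < 2 * (\<delta> * (norm w + 1))" using \<delta> by (simp add: algebra_simps)
  also have "\<delta> * (norm w + 1) = e / 2"
    using n by (intro nonzero_eq_divide_eq[THEN iffD1] \<delta>_def) simp
  finally have less: "2 * \<delta> * norm w < e" by simp
  from est[OF \<delta>] show "\<forall>\<^sub>F l in F. dist (lag_U (Gr (M l)) *v w) (mat 1 *v w) < e"
  proof eventually_elim
    case (elim l)
    then show ?case using lag_U_Gr_near_1[OF M \<delta>, of l w] less by (simp add: dist_norm)
  qed
qed

lemma tendsto_vjoin:
  fixes f :: "'b \<Rightarrow> 'a::topological_space^'m::finite" and g :: "'b \<Rightarrow> 'a^'k::finite"
  assumes "(f \<longlongrightarrow> a) F" "(g \<longlongrightarrow> b) F"
  shows "((\<lambda>x. vjoin (f x) (g x)) \<longlongrightarrow> vjoin a b) F"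
proof (rule vec_tendstoI)
  fix i :: "'m + 'k"
  show "((\<lambda>x. vjoin (f x) (g x) $ i) \<longlongrightarrow> vjoin a b $ i) F"
    using assms by (cases i) (auto intro: tendsto_vec_nth)
qed

lemma tendsto_vfst_vsnd:
  fixes f :: "'b \<Rightarrow> 'a::topological_space^('m::finite + 'k::finite)"
  assumes "(f \<longlongrightarrow> a) F"
  shows "((\<lambda>x. vfst (f x)) \<longlongrightarrow> vfst a) F" "((\<lambda>x. vsnd (f x)) \<longlongrightarrow> vsnd a) F"
proof -
  have "((\<lambda>x. vfst (f x) $ i) \<longlongrightarrow> vfst a $ i) F" "((\<lambda>x. vsnd (f x) $ j) \<longlongrightarrow> vsnd a $ j) F" for i j
    unfolding vfst_def vsnd_def vec_lambda_beta by (rule tendsto_vec_nth[OF assms])+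
  from vec_tendstoI[OF this(1)] vec_tendstoI[OF this(2)]
  show "((\<lambda>x. vfst (f x)) \<longlongrightarrow> vfst a) F" "((\<lambda>x. vsnd (f x)) \<longlongrightarrow> vsnd a) F" .
qed

lemma tendsto_complex_matrix_vector:
  fixes M :: "'b \<Rightarrow> real^'m::finite^'k::finite"
  assumes "\<And>u. ((\<lambda>l. M l *v u) \<longlongrightarrow> N *v u) F"
  shows "((\<lambda>l. map_matrix complex_of_real (M l) *v u) \<longlongrightarrow> map_matrix complex_of_real N *v u) F"
proof (rule vec_tendstoI)
  fix i
  have eq: "(map_matrix complex_of_real A *v u) $ i = Complex ((A *v vRe u) $ i) ((A *v vIm u) $ i)" for A :: "real^'m^'k"
    unfolding vRe_vIm_mult[symmetric] by (simp add: vRe_def vIm_def del: vRe_vIm_mult)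
  show "((\<lambda>l. (map_matrix complex_of_real (M l) *v u) $ i) \<longlongrightarrow> (map_matrix complex_of_real N *v u) $ i) F"
    unfolding eq by (intro tendsto_Complex tendsto_vec_nth assms)
qed

text \<open>The \<open>u\<close> that represents \<open>w\<close> on the limit graph is kept and
  gives \<open>w_l = a' l - \<i> b' l\<close> on \<open>Gr (M l)\<close>. In
  \<open>U_l w = U_l (w - w_l) + U_l w_l\<close> the first term has norm \<open>|w - w_l|\<close> by
  unitarity and tends to 0; the second is \<open>a' l + \<i> b' l\<close>, which tends to
  \<open>a + \<i> b\<close>.\<close>

lemma tendsto_lag_U_Gr:
  fixes M :: "'b \<Rightarrow> real^('n::finite + 'n)^('n + 'n)"
  assumes M: "\<And>l. symplectic (M l)" "symplectic N"
    and lim: "\<And>u. ((\<lambda>l. M l *v u) \<longlongrightarrow> N *v u) F"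
  shows "((\<lambda>l. lag_U (Gr (M l))) \<longlongrightarrow> lag_U (Gr N)) F"
proof (rule tendsto_matrix)
  fix w :: "complex^('n + 'n)"
  obtain a b where ab: "vjoin a b \<in> canon ` Gr N" "a - \<i> *s b = w" "a + \<i> *s b = lag_U (Gr N) *v w"
    by (rule lag_U_coords[OF Gr_mem_Lag[OF M(2)]])
  obtain u where u: "a = vjoin (- vfst u) (vfst (map_matrix complex_of_real N *v u))"
    "b = vjoin (vsnd u) (vsnd (map_matrix complex_of_real N *v u))"
    using ab(1) by (rule Gr_coords)
  define a' where "a' l = vjoin (- vfst u) (vfst (map_matrix complex_of_real (M l) *v u))" for l
  define b' where "b' l = vjoin (vsnd u) (vsnd (map_matrix complex_of_real (M l) *v u))" for l
  have "canon (vjoin u (map_matrix complex_of_real (M l) *v u)) = vjoin (a' l) (b' l)" for l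
    by (simp add: canon_def a'_def b'_def)
  then have "vjoin (a' l) (b' l) \<in> canon ` Gr (M l)" for l
    unfolding Gr_def by (metis (mono_tags, lifting) imageI mem_Collect_eq)
  then have U: "a' l + \<i> *s b' l = lag_U (Gr (M l)) *v (a' l - \<i> *s b' l)" for l
    by (simp add: canon_mem_lag_U[OF Gr_mem_Lag[OF M(1)], symmetric])
  have scale: "((\<lambda>l. \<i> *s f l) \<longlongrightarrow> \<i> *s c) F" if "(f \<longlongrightarrow> c) F" for f :: "'b \<Rightarrow> complex^('n + 'n)" and c
  proof (rule vec_tendstoI)
    show "((\<lambda>l. (\<i> *s f l) $ i) \<longlongrightarrow> (\<i> *s c) $ i) F" for i
      unfolding vector_smult_component by (rule tendsto_mult_left[OF tendsto_vec_nth[OF that]])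
  qed
  have c: "((\<lambda>l. map_matrix complex_of_real (M l) *v u) \<longlongrightarrow> map_matrix complex_of_real N *v u) F"
    by (intro tendsto_complex_matrix_vector lim)
  have ab': "(a' \<longlongrightarrow> a) F" "(b' \<longlongrightarrow> b) F"
    unfolding a'_def[abs_def] b'_def[abs_def] u
    by (rule tendsto_vjoin[OF tendsto_const tendsto_vfst_vsnd(1)[OF c]])
      (rule tendsto_vjoin[OF tendsto_const tendsto_vfst_vsnd(2)[OF c]])
  have p: "((\<lambda>l. a' l + \<i> *s b' l) \<longlongrightarrow> a + \<i> *s b) F" and m: "((\<lambda>l. a' l - \<i> *s b' l) \<longlongrightarrow> a - \<i> *s b) F"
    by (rule tendsto_add[OF ab'(1) scale[OF ab'(2)]]) (rule tendsto_diff[OF ab'(1) scale[OF ab'(2)]])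
  have "((\<lambda>l. w - (a' l - \<i> *s b' l)) \<longlongrightarrow> 0) F"
    using tendsto_diff[OF tendsto_const m, of w] by (simp add: ab(2))
  from tendsto_norm_zero[OF this]
  have "((\<lambda>l. norm (lag_U (Gr (M l)) *v (w - (a' l - \<i> *s b' l)))) \<longlongrightarrow> 0) F"
    by (simp only: norm_lag_U_mult[OF Gr_mem_Lag[OF M(1)]])
  then have "((\<lambda>l. lag_U (Gr (M l)) *v (w - (a' l - \<i> *s b' l))) \<longlongrightarrow> 0) F"
    by (rule tendsto_norm_zero_cancel)
  from tendsto_add[OF this p]
  show "((\<lambda>l. lag_U (Gr (M l)) *v w) \<longlongrightarrow> lag_U (Gr N) *v w) F"
    by (simp add: U ab(3) matrix_vector_mult_diff_distrib)
qed

theorem theorem1p7: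
  fixes P Q R :: "real \<Rightarrow> real^'n::finite^'n" and T :: real
    and \<gamma> :: "real \<Rightarrow> real \<Rightarrow> real^('n::finite + 'n)^('n + 'n)"
  assumes "T > 0"
    and "H1_on T P" and "H1_on T Q" and "continuous_on {0..T} R"
    and "\<And>t. t \<in> {0..T} \<Longrightarrow> symmetric_mat (P t)"
    and "\<And>t. t \<in> {0..T} \<Longrightarrow> symmetric_mat (R t)"
    and "\<And>t. t \<in> {0..T} \<Longrightarrow> positive_definite (P t)"
    and "\<And>l. fundamental_solution T (\<lambda>t. J_mat ** B_mat P Q R l t) (\<gamma> l)"
  shows "limitin lag_topology (\<lambda>l. Gr (\<gamma> l T)) Lambda_D at_bot \<and>
    (\<forall>\<^sub>F \<epsilon> in at_right 0.
       continuous_map (top_of_set {- pi / 2..- pi / 2 + \<epsilon>}) lag_topology (graph_path \<gamma> T) \<and>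
       maslov Lambda_D (graph_path \<gamma> T) (- pi / 2) (- pi / 2 + \<epsilon>) = 2 * int CARD('n))"
proof -
  obtain p where p: "p > 0" "\<And>t v. t \<in> {0..T} \<Longrightarrow> p * (norm v)\<^sup>2 \<le> v \<bullet> (P t *v v)"
    using uniformly_positive_definite[OF H1_on_imp_continuous_on[OF assms(2)] assms(7)] by blast
  obtain q where q: "q \<ge> 0" "\<And>t v. t \<in> {0..T} \<Longrightarrow> norm (Q t *v v) \<le> q * norm v"
    using matrix_norm_bound[OF H1_on_imp_continuous_on[OF assms(3)]] by blast
  obtain r where r: "r \<ge> 0" "\<And>t v. t \<in> {0..T} \<Longrightarrow> norm (R t *v v) \<le> r * norm v"
    using matrix_norm_bound[OF assms(4)] by blast
  have sym: "t \<in> {0..T} \<Longrightarrow> transpose (P t) = P t" "t \<in> {0..T} \<Longrightarrow> transpose (R t) = R t" for t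
    using assms(5,6) by (simp_all add: symmetric_mat_def)
  interpret sturm_liouville_flow P Q R T p q r \<gamma>
    by (rule sturm_liouville_flow.intro[OF sturm_liouville.intro[OF assms(1) p(1) q(1) r(1) sym p(2) q(2) r(2)]
          sturm_liouville_flow_axioms.intro[OF assms(7,8)]])
  have symp: "symplectic (\<gamma> l T)" for l using T by (intro symplectic_flow) auto
  note Gr_Lag = Gr_mem_Lag[OF symp]
  have lim: "((\<lambda>l. lag_U (Gr (\<gamma> l T))) \<longlongrightarrow> lag_U (Lambda_D :: 'n bdry set)) at_bot"
    unfolding lag_U_Lambda_D
  proof (rule tendsto_lag_U_mat_1[OF symp])
    fix \<delta> :: real assume \<delta>: "\<delta> > 0"
    show "\<forall>\<^sub>F l in at_bot. \<forall>u. (norm (vsnd u))\<^sup>2 + (norm (vsnd (\<gamma> l T *v u)))\<^sup>2 \<le> \<delta> * boundary_form (\<gamma> l T) u"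
      using eventually_le_at_bot[of "threshold \<delta>"]
      by eventually_elim (use flow_boundary_estimate[OF \<delta>] in blast)
  qed
  let ?a = "- (pi / 2)"
  have path: "graph_path \<gamma> T s = (if s = ?a then Lambda_D else Gr (\<gamma> (tan s) T))" for s
    by (simp add: graph_path_def)
  have path_Lag: "graph_path \<gamma> T s \<in> Lag" for s by (simp add: path Gr_Lag Lambda_D_mem_Lag)
  \<comment> \<open>At \<open>?a\<close> this is the limit \<open>lim\<close>, composed with the
    divergence of \<open>tan\<close> to minus infinity from the right; elsewhere
    \<open>\<epsilon> < pi\<close> keeps \<open>s\<close> below \<open>pi / 2\<close>, where
    \<open>tan\<close> is continuous.\<close>
  have cont: "continuous_on {?a..?a + \<epsilon>} (\<lambda>s. lag_U (graph_path \<gamma> T s))" if \<epsilon>: "0 < \<epsilon>" "\<epsilon> < pi" for \<epsilon>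
    unfolding continuous_on_def
  proof
    fix s assume s: "s \<in> {?a..?a + \<epsilon>}"
    show "((\<lambda>s. lag_U (graph_path \<gamma> T s)) \<longlongrightarrow> lag_U (graph_path \<gamma> T s)) (at s within {?a..?a + \<epsilon>})"
    proof (cases "s = ?a")
      case True
      have "((\<lambda>s. lag_U (Gr (\<gamma> (tan s) T))) \<longlongrightarrow> lag_U (Lambda_D :: 'n bdry set)) (at_right ?a)"
        by (rule filterlim_compose[OF lim filterlim_tan_at_right])
      then have "((\<lambda>s. lag_U (graph_path \<gamma> T s)) \<longlongrightarrow> lag_U (Lambda_D :: 'n bdry set)) (at_right ?a)"
        by (rule Lim_transform_within_open[of _ _ _ _ UNIV]) (auto simp: path)
      moreover have "at ?a within {?a..?a + \<epsilon>} = at_right ?a"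
        using \<epsilon> by (intro at_within_Icc_at_right) auto
      ultimately show ?thesis using True by (simp add: path)
    next
      case False
      then have "s > ?a" "s < pi / 2" using s \<epsilon> by auto
      then have "cos s \<noteq> 0" using cos_gt_zero_pi[of s] by simp
      then have "isCont tan s" by (rule isCont_tan)
      moreover have "isCont (\<lambda>l. lag_U (Gr (\<gamma> l T))) (tan s)"
        unfolding isCont_def by (rule tendsto_lag_U_Gr[OF symp symp tendsto_flow])
      ultimately have "isCont (\<lambda>s. lag_U (Gr (\<gamma> (tan s) T))) s" by (rule isCont_o2)
      then have "((\<lambda>s. lag_U (Gr (\<gamma> (tan s) T))) \<longlongrightarrow> lag_U (graph_path \<gamma> T s)) (at s within {?a..?a + \<epsilon>})"
        using False unfolding isCont_def by (simp add: path tendsto_within_subset[OF _ subset_UNIV])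
      then show ?thesis
        by (rule Lim_transform_within_open[of _ _ _ _ "- {?a}"]) (use False in \<open>auto simp: path\<close>)
    qed
  qed
  \<comment> \<open>A bound at the right end of the interval suffices: \<open>tan\<close> is
    increasing, so it holds at every point of the path after \<open>?a\<close>.\<close>
  have "\<forall>\<^sub>F \<epsilon> in at_right 0. tan (\<epsilon> + ?a) \<le> threshold 1"
    using filterlim_tan_at_right
    by (simp only: filterlim_at_right_to_0[of tan at_bot ?a]) (simp only: filterlim_at_bot)
  moreover have "\<forall>\<^sub>F \<epsilon> in at_right 0. \<epsilon> < pi" "\<forall>\<^sub>F \<epsilon> in at_right 0. 0 < (\<epsilon> :: real)"
    by (auto simp: eventually_at_right_field intro: exI[of _ pi])
  ultimately have "\<forall>\<^sub>F \<epsilon> in at_right 0.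
       continuous_map (top_of_set {?a..?a + \<epsilon>}) lag_topology (graph_path \<gamma> T) \<and>
       maslov Lambda_D (graph_path \<gamma> T) ?a (?a + \<epsilon>) = 2 * int CARD('n)"
  proof eventually_elim
    case (elim \<epsilon>)
    note c = cont[OF elim(3) elim(2)]
    have "maslov Lambda_D (graph_path \<gamma> T) ?a (?a + \<epsilon>) = 2 * int CARD('n)"
    proof (rule maslov_Lambda_D[OF _ _ path_Lag c])
      fix t and u v :: "complex^('n + 'n)"
      assume t: "t \<in> {?a<..?a + \<epsilon>}" and uv: "vjoin u v \<in> canon ` graph_path \<gamma> T t" "u \<noteq> 0 \<or> v \<noteq> 0"
      have "tan t \<le> tan (\<epsilon> + ?a)"
      proof (cases "t = \<epsilon> + ?a")
        case False
        then show ?thesis using t elim(2) by (intro less_imp_le tan_monotone) auto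
      qed simp
      then have "tan t \<le> threshold 1" using elim(1) by simp
      moreover have "vjoin u v \<in> canon ` Gr (\<gamma> (tan t) T)" using uv(1) t by (simp add: path)
      ultimately show "0 < u \<bullet> v" using uv(2) flow_boundary_form_pos by (intro Gr_inner_pos) auto
    qed (use elim in \<open>auto simp: path\<close>)
    then show ?case using continuous_map_lag_topology[OF path_Lag c] by blast
  qed
  then show ?thesis
    using limitin_lag_topology[OF Gr_Lag Lambda_D_mem_Lag lim] by simp
qed

end
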